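(* For every $t\in\mathbb{N}$, the class of graphs containing no induced cycle $C_\ell$ with $\ell\ge t$ is strongly QP-dispersible and $\tfrac12$-uniformly dispersible.
   Context: For a graph $G$, $\mathbf{w}\colon V(G)\to\mathbb{N}$, $\mathbf{w}(S)=\sum_{v\in S}\mathbf{w}(v)$; $\mathbf{w}_I$ equals $\mathbf{w}$ on $I$ and $0$ elsewhere. For $X\subseteq V(G)$, $X$ is $(\gamma,\delta)$-good for $\mathbf{w}$ if $\mathbf{w}(X)\le\gamma\mathbf{w}(V(G))$ and for every connected component $C$ of $G-X$ that is not a single isolated vertex of $G$, $\mathbf{w}(V(C))\le(1-\delta)\mathbf{w}(V(G))$ and $\mathbf{w}(X)\le\gamma\mathbf{w}(V(G)\setminus V(C))$. A strong $(\gamma,\delta)$-disperser for $(G,\mathbf{w})$ is a family $\mathcal{D}$ of subsets of $V(G)$ such that for every independent set $I$ with $\mathbf{w}(I)>0$ some $X\in\mathcal{D}$ is $(\gamma,\delta)$-good for $\mathbf{w}_I$. A hereditary class $\mathcal{C}$ is strongly QP-dispersible if there is a polynomial $q$ such that for every $\gamma\in(0,1/2)$ there are a nonincreasing $\delta\colon\mathbb{N}\to(0,1/2)$ with $\delta(n)^{-1}\le q(\log n,\gamma^{-1})$, computable in polynomial time from $\gamma,n$, and an algorithm that, given an $n$-vertex $G\in\mathcal{C}$ and $\mathbf{w}$, runs in time $2^{q(\log n,\gamma^{-1})}$ and outputs a strong $(\gamma,\delta(n))$-disperser of size at most $2^{q(\log n,\gamma^{-1})}$. An extended strip decomposition of $G$: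 a simple nonempty graph $H$, sets $\eta(e)$ for edges $e=uv$ of $H$ with $\eta(e,u),\eta(e,v)\subseteq\eta(e)$, sets $\eta(v)$ for $v\in V(H)$, sets $\eta(T)$ for triangles $T$ of $H$, partitioning $V(G)$, with $\eta(vu,v)$ complete to $\eta(vw,v)$ for distinct edges $vu,vw$, and every edge of $G$ inside some $\eta(e),\eta(v),\eta(T)$, or between $\eta(e,v)$ and $\eta(e',v)$ for distinct edges $e,e'$ at $v$, or between $\eta(v)$ and $\eta(e,v)$, or between $\eta(T)$ and $\eta(e,u)\cap\eta(e,v)$ for an edge $e=uv$ of triangle $T$. Its atoms: $A_e^\bot=\eta(e)\setminus(\eta(e,u)\cup\eta(e,v))$, $A_e^u=\eta(u)\cup(\eta(e)\setminus\eta(e,v))$, $A_e^v$ symmetric, $A_e^{uv}=\eta(u)\cup\eta(v)\cup\eta(e)\cup\bigcup_{T\ni e}\eta(T)$, $A_v=\eta(v)$, $A_T=\eta(T)$. A $\xi$-uniform disperser for $G$ is a pair $(X,(H,\eta))$, $(H,\eta)$ an extended strip decomposition of $G-X$, with $|X|\le|V(G)|^{-\xi}|V(G)\setminus A|$ and $|A|\le|V(G)|-|V(G)|^{\xi}$ for every atom $A$. A hereditary class is $\xi$-uniformly dispersible if there exist constants $n_0>0,\tau>0$ and a polynomial-time algorithm that, given a connected $G$ in the class with $n\ge n_0$ vertices and $|N[v]|\le\tau n^{\xi}$ for all $v$, outputs a $\xi$-uniform disperser for $G$.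
   Formalization: In the definition of a (γ,δ)-good set, the exempted components are the single-vertex components of G−X rather than the isolated vertices of G; with the latter, K_2 with weight on one vertex admits no good set, so the claim would fail for every t. *)

theory Defs
  imports Complex_Main "HOL-Library.Disjoint_Sets" "HOL-Computational_Algebra.Polynomial"
begin

section \<open>Graphs\<close>

record 'a graph =
  verts :: "'a set"
  edges :: "'a set set"

definition simple_graph :: "'a graph \<Rightarrow> bool" where
  "simple_graph G \<longleftrightarrow> finite (verts G) \<and> (\<forall>e\<in>edges G. e \<subseteq> verts G \<and> card e = 2)"

definition adj :: "'a graph \<Rightarrow> 'a \<Rightarrow> 'a \<Rightarrow> bool" where
  "adj G u v \<longleftrightarrow> {u, v} \<in> edges G"

definition induced :: "'a graph \<Rightarrow> 'a set \<Rightarrow> 'a graph" where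
  "induced G S = \<lparr>verts = verts G \<inter> S, edges = {e \<in> edges G. e \<subseteq> S}\<rparr>"

definition delete_verts :: "'a graph \<Rightarrow> 'a set \<Rightarrow> 'a graph" where
  "delete_verts G X = induced G (verts G - X)"

definition isomorphic :: "'a graph \<Rightarrow> 'b graph \<Rightarrow> bool" where
  "isomorphic G H \<longleftrightarrow> (\<exists>f. bij_betw f (verts G) (verts H) \<and>
     (\<forall>u\<in>verts G. \<forall>v\<in>verts G. adj G u v \<longleftrightarrow> adj H (f u) (f v)))"

definition closed_nbhd :: "'a graph \<Rightarrow> 'a \<Rightarrow> 'a set" where
  "closed_nbhd G v = insert v {u \<in> verts G. adj G v u}"

definition independent :: "'a graph \<Rightarrow> 'a set \<Rightarrow> bool" where
  "independent G I \<longleftrightarrow> I \<subseteq> verts G \<and> (\<forall>u\<in>I. \<forall>v\<in>I. \<not> adj G u v)"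

definition component_of :: "'a graph \<Rightarrow> 'a \<Rightarrow> 'a set" where
  "component_of G v = {u. (v, u) \<in> {(x, y). adj G x y}\<^sup>*}"

definition components :: "'a graph \<Rightarrow> 'a set set" where
  "components G = component_of G ` verts G"

definition connected_graph :: "'a graph \<Rightarrow> bool" where
  "connected_graph G \<longleftrightarrow> verts G \<noteq> {} \<and> (\<forall>v\<in>verts G. component_of G v = verts G)"

text \<open>Meaningful for \<open>l \<ge> 3\<close> only.\<close>

definition cycle_graph :: "nat \<Rightarrow> nat graph" where
  "cycle_graph l = \<lparr>verts = {..<l}, edges = {{i, Suc i mod l} | i. i < l}\<rparr>"

definition has_induced :: "'a graph \<Rightarrow> 'b graph \<Rightarrow> bool" where
  "has_induced G H \<longleftrightarrow> (\<exists>S\<subseteq>verts G. isomorphic (induced G S) H)"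

text \<open>Graph classes are sets of finite simple graphs whose vertices are natural numbers; up to
  isomorphism this is every finite simple graph.\<close>

definition long_cycle_free :: "nat \<Rightarrow> nat graph set" where
  "long_cycle_free t =
     {G. simple_graph G \<and> (\<forall>l. l \<ge> 3 \<and> l \<ge> t \<longrightarrow> \<not> has_induced G (cycle_graph l))}"

definition hereditary :: "nat graph set \<Rightarrow> bool" where
  "hereditary \<C> \<longleftrightarrow> (\<forall>G\<in>\<C>. simple_graph G) \<and>
     (\<forall>G\<in>\<C>. \<forall>S\<subseteq>verts G. induced G S \<in> \<C>) \<and>
     (\<forall>G\<in>\<C>. \<forall>H. simple_graph H \<and> isomorphic G H \<longrightarrow> H \<in> \<C>)"


section \<open>Strong dispersers\<close>

definition restrict_weight :: "('a \<Rightarrow> nat) \<Rightarrow> 'a set \<Rightarrow> 'a \<Rightarrow> nat" where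
  "restrict_weight w I v = (if v \<in> I then w v else 0)"

text \<open>The exempted components are the one-vertex components of \<open>G - X\<close>, i.e. the isolated vertices
  of \<open>G - X\<close>. Exempting only vertices that are isolated already in \<open>G\<close> would leave no good set
  for \<open>G = K\<^sub>2\<close> and a weight concentrated on one vertex: that vertex cannot be in \<open>X\<close>,
  and its component would carry the full weight.\<close>

definition good_set :: "'a graph \<Rightarrow> ('a \<Rightarrow> nat) \<Rightarrow> real \<Rightarrow> real \<Rightarrow> 'a set \<Rightarrow> bool" where
  "good_set G w \<gamma> \<delta> X \<longleftrightarrow> X \<subseteq> verts G \<and>
     real (sum w X) \<le> \<gamma> * real (sum w (verts G)) \<and>
     (\<forall>C\<in>components (delete_verts G X). \<not> is_singleton C \<longrightarrow>
        real (sum w C) \<le> (1 - \<delta>) * real (sum w (verts G)) \<and>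
        real (sum w X) \<le> \<gamma> * real (sum w (verts G - C)))"

definition strong_disperser ::
  "'a graph \<Rightarrow> ('a \<Rightarrow> nat) \<Rightarrow> real \<Rightarrow> real \<Rightarrow> 'a set set \<Rightarrow> bool" where
  "strong_disperser G w \<gamma> \<delta> \<D> \<longleftrightarrow> (\<forall>X\<in>\<D>. X \<subseteq> verts G) \<and>
     (\<forall>I. independent G I \<and> sum w I > 0 \<longrightarrow>
        (\<exists>X\<in>\<D>. good_set G (restrict_weight w I) \<gamma> \<delta> X))"


section \<open>Extended strip decompositions\<close>

definition triangles :: "'b graph \<Rightarrow> 'b set set" where
  "triangles H = {T. T \<subseteq> verts H \<and> card T = 3 \<and> (\<forall>u\<in>T. \<forall>v\<in>T. u \<noteq> v \<longrightarrow> adj H u v)}"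

text \<open>Vertices, edges and triangles of \<open>H\<close> are uniformly represented by vertex sets of size 1, 2
  and 3, so that \<open>\<eta>(v)\<close>, \<open>\<eta>(e)\<close>, \<open>\<eta>(T)\<close> become \<open>\<eta> {v}\<close>, \<open>\<eta> e\<close>, \<open>\<eta> T\<close>. The sets
  \<open>\<eta>(e,u)\<close> are given by a separate function \<open>\<iota>\<close>, as \<open>\<iota> e u\<close>.\<close>

definition objects :: "'b graph \<Rightarrow> 'b set set" where
  "objects H = (\<lambda>v. {v}) ` verts H \<union> edges H \<union> triangles H"

definition extended_strip_decomposition ::
  "'a graph \<Rightarrow> 'b graph \<Rightarrow> ('b set \<Rightarrow> 'a set) \<Rightarrow> ('b set \<Rightarrow> 'b \<Rightarrow> 'a set) \<Rightarrow> bool" where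
  "extended_strip_decomposition G H \<eta> \<iota> \<longleftrightarrow>
     simple_graph H \<and> verts H \<noteq> {} \<and>
     (\<forall>e\<in>edges H. \<forall>u\<in>e. \<iota> e u \<subseteq> \<eta> e) \<and>
     disjoint_family_on \<eta> (objects H) \<and> (\<Union>z\<in>objects H. \<eta> z) = verts G \<and>
     (\<forall>e\<in>edges H. \<forall>f\<in>edges H. \<forall>v\<in>e \<inter> f. e \<noteq> f \<longrightarrow>
        (\<forall>x\<in>\<iota> e v. \<forall>y\<in>\<iota> f v. adj G x y)) \<and>
     (\<forall>d\<in>edges G. \<exists>x y. d = {x, y} \<and>
        ((\<exists>z\<in>objects H. x \<in> \<eta> z \<and> y \<in> \<eta> z) \<or>
         (\<exists>e\<in>edges H. \<exists>f\<in>edges H. \<exists>v\<in>e \<inter> f. e \<noteq> f \<and> x \<in> \<iota> e v \<and> y \<in> \<iota> f v) \<or>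
         (\<exists>e\<in>edges H. \<exists>v\<in>e. x \<in> \<eta> {v} \<and> y \<in> \<iota> e v) \<or>
         (\<exists>T\<in>triangles H. \<exists>u v. {u, v} \<in> edges H \<and> {u, v} \<subseteq> T \<and>
            x \<in> \<eta> T \<and> y \<in> \<iota> {u, v} u \<inter> \<iota> {u, v} v)))"

definition atoms ::
  "'b graph \<Rightarrow> ('b set \<Rightarrow> 'a set) \<Rightarrow> ('b set \<Rightarrow> 'b \<Rightarrow> 'a set) \<Rightarrow> 'a set set" where
  "atoms H \<eta> \<iota> =
     {\<eta> {u, v} - (\<iota> {u, v} u \<union> \<iota> {u, v} v) | u v. {u, v} \<in> edges H} \<union>
     {\<eta> {u} \<union> (\<eta> {u, v} - \<iota> {u, v} v) | u v. {u, v} \<in> edges H} \<union>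
     {\<eta> {u} \<union> \<eta> {v} \<union> \<eta> {u, v} \<union> \<Union> (\<eta> ` {T \<in> triangles H. {u, v} \<subseteq> T}) | u v.
        {u, v} \<in> edges H} \<union>
     {\<eta> {v} | v. v \<in> verts H} \<union>
     {\<eta> T | T. T \<in> triangles H}"

definition uniform_disperser ::
  "real \<Rightarrow> 'a graph \<Rightarrow> 'a set \<Rightarrow> 'b graph \<Rightarrow> ('b set \<Rightarrow> 'a set) \<Rightarrow> ('b set \<Rightarrow> 'b \<Rightarrow> 'a set) \<Rightarrow> bool"
  where
  "uniform_disperser \<xi> G X H \<eta> \<iota> \<longleftrightarrow> X \<subseteq> verts G \<and>
     extended_strip_decomposition (delete_verts G X) H \<eta> \<iota> \<and>
     (\<forall>A\<in>atoms H \<eta> \<iota>.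
        real (card X) \<le> real (card (verts G)) powr (- \<xi>) * real (card (verts G - A)) \<and>
        real (card A) \<le> real (card (verts G)) - real (card (verts G)) powr \<xi>)"


section \<open>Model of computation\<close>

text \<open>A structured random access machine: finitely many registers and (two-dimensional) arrays
  holding natural numbers, every elementary operation costing one unit. The only arithmetic
  operations are addition and truncated subtraction, so that a run of \<open>T\<close> steps lengthens
  numbers by at most \<open>T\<close> bits plus a constant, and the running time agrees with that of
  Turing machines up to a polynomial in \<open>T\<close> and the bit length of the input (multiplication at
  unit cost would destroy this). A number given as input, such as a vertex weight, occupies one
  register or array cell irrespective of its magnitude.\<close>

datatype aexp =
    Const nat
  | Var string
  | Cell string aexp aexp
  | Add aexp aexp
  | Sub aexp aexp

datatype bexp =
    Less aexp aexp
  | BNot bexp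
  | BAnd bexp bexp

datatype com =
    Skip
  | Assign string aexp
  | Store string aexp aexp aexp
  | Seq com com
  | Cond bexp com com
  | While bexp com

record state =
  regs :: "string \<Rightarrow> nat"
  cells :: "string \<Rightarrow> nat \<Rightarrow> nat \<Rightarrow> nat"

primrec aval :: "state \<Rightarrow> aexp \<Rightarrow> nat" where
  "aval s (Const k) = k"
| "aval s (Var x) = regs s x"
| "aval s (Cell A i j) = cells s A (aval s i) (aval s j)"
| "aval s (Add a b) = aval s a + aval s b"
| "aval s (Sub a b) = aval s a - aval s b"

primrec acost :: "aexp \<Rightarrow> nat" where
  "acost (Const k) = 1"
| "acost (Var x) = 1"
| "acost (Cell A i j) = 1 + acost i + acost j"
| "acost (Add a b) = 1 + acost a + acost b"
| "acost (Sub a b) = 1 + acost a + acost b"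

primrec bval :: "state \<Rightarrow> bexp \<Rightarrow> bool" where
  "bval s (Less a b) \<longleftrightarrow> aval s a < aval s b"
| "bval s (BNot c) \<longleftrightarrow> \<not> bval s c"
| "bval s (BAnd c d) \<longleftrightarrow> bval s c \<and> bval s d"

primrec bcost :: "bexp \<Rightarrow> nat" where
  "bcost (Less a b) = 1 + acost a + acost b"
| "bcost (BNot c) = 1 + bcost c"
| "bcost (BAnd c d) = 1 + bcost c + bcost d"

definition store :: "string \<Rightarrow> nat \<Rightarrow> nat \<Rightarrow> nat \<Rightarrow> state \<Rightarrow> state" where
  "store A i j k s = s\<lparr>cells := (cells s)(A := (cells s A)(i := (cells s A i)(j := k)))\<rparr>"

text \<open>\<open>exec c s T s'\<close>: the program \<open>c\<close>, started in \<open>s\<close>, halts in state \<open>s'\<close> after \<open>T\<close> steps.\<close>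

inductive exec :: "com \<Rightarrow> state \<Rightarrow> nat \<Rightarrow> state \<Rightarrow> bool" where
  exec_Skip: "exec Skip s 1 s"
| exec_Assign:
    "exec (Assign x a) s (1 + acost a) (s\<lparr>regs := (regs s)(x := aval s a)\<rparr>)"
| exec_Store:
    "exec (Store A i j a) s (1 + acost i + acost j + acost a)
       (store A (aval s i) (aval s j) (aval s a) s)"
| exec_Seq:
    "exec c s T s' \<Longrightarrow> exec d s' T' s'' \<Longrightarrow> exec (Seq c d) s (T + T') s''"
| exec_Cond_True:
    "bval s b \<Longrightarrow> exec c s T s' \<Longrightarrow> exec (Cond b c d) s (1 + bcost b + T) s'"
| exec_Cond_False:
    "\<not> bval s b \<Longrightarrow> exec d s T s' \<Longrightarrow> exec (Cond b c d) s (1 + bcost b + T) s'"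
| exec_While_False:
    "\<not> bval s b \<Longrightarrow> exec (While b c) s (1 + bcost b) s"
| exec_While_True:
    "bval s b \<Longrightarrow> exec c s T s' \<Longrightarrow> exec (While b c) s' T' s'' \<Longrightarrow>
       exec (While b c) s (1 + bcost b + T + T') s''"

lemma exec_deterministic:
  "exec c s T s' \<Longrightarrow> exec c s T' s'' \<Longrightarrow> T' = T \<and> s'' = s'"
proof (induction arbitrary: T' s'' rule: exec.induct)
  case (exec_Seq c s T1 s1 d T2 s2)
  from exec_Seq.prems obtain U1 u U2
    where "exec c s U1 u" "exec d u U2 s''" "T' = U1 + U2"
    by (cases rule: exec.cases) auto
  with exec_Seq.IH show ?case by blast
next
  case (exec_While_True s b c T1 s1 T2 s2)
  from exec_While_True.prems exec_While_True.hyps obtain U1 u U2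
    where "exec c s U1 u" "exec (While b c) u U2 s''" "T' = 1 + bcost b + U1 + U2"
    by (cases rule: exec.cases) auto
  with exec_While_True.IH show ?case by blast
qed (erule exec.cases; fastforce)+

definition blank :: state where
  "blank = \<lparr>regs = (\<lambda>_. 0), cells = (\<lambda>_ _ _. 0)\<rparr>"


section \<open>Encoding of inputs and outputs\<close>

text \<open>An input graph has vertex set \<open>{..<n}\<close> and is given by \<open>n\<close> and its adjacency matrix.\<close>

definition graph_input :: "nat graph \<Rightarrow> state" where
  "graph_input G = blank
     \<lparr>regs := (\<lambda>_. 0)(''n'' := card (verts G)),
      cells := (\<lambda>_ _ _. 0)(''E'' := (\<lambda>u v. if adj G u v then 1 else 0))\<rparr>"

definition weighted_graph_input :: "nat graph \<Rightarrow> (nat \<Rightarrow> nat) \<Rightarrow> state" where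
  "weighted_graph_input G w = (graph_input G)
     \<lparr>cells := (cells (graph_input G))
        (''w'' := (\<lambda>v j. if v \<in> verts G \<and> j = 0 then w v else 0))\<rparr>"

text \<open>A family of subsets of \<open>{..<n}\<close> is output as the list of the characteristic vectors of its
  members, in rows \<open>0, \<dots>, m - 1\<close> of an array.\<close>

definition out_family :: "nat \<Rightarrow> state \<Rightarrow> nat set set" where
  "out_family n s = (\<lambda>i. {v. v < n \<and> cells s ''D'' i v \<noteq> 0}) ` {..<regs s ''m''}"

text \<open>Since the sets \<open>\<eta> z\<close> partition \<open>V(G) - X\<close>, the function \<open>\<eta>\<close> is output by listing, for each
  vertex \<open>x\<close>, the (at most three) elements of the object \<open>z\<close> with \<open>x \<in> \<eta> z\<close>. If \<open>z\<close> is an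
  edge, the set of all \<open>u \<in> z\<close> with \<open>x \<in> \<iota> z u\<close> is output as a characteristic vector.\<close>

definition out_set :: "nat \<Rightarrow> state \<Rightarrow> nat set" where
  "out_set n s = {v. v < n \<and> cells s ''X'' v 0 \<noteq> 0}"

definition out_pattern :: "state \<Rightarrow> nat graph" where
  "out_pattern s = \<lparr>verts = {..<regs s ''h''},
     edges = {{a, b} | a b. a < b \<and> b < regs s ''h'' \<and> cells s ''H'' a b \<noteq> 0}\<rparr>"

definition out_eta :: "nat \<Rightarrow> state \<Rightarrow> nat set \<Rightarrow> nat set" where
  "out_eta n s z = {x. x < n \<and> x \<notin> out_set n s \<and>
     z = {cells s ''L'' x 0, cells s ''L'' x 1, cells s ''L'' x 2}}"

definition out_iota :: "nat \<Rightarrow> state \<Rightarrow> nat set \<Rightarrow> nat \<Rightarrow> nat set" where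
  "out_iota n s e u = {x \<in> out_eta n s e. cells s ''F'' x u \<noteq> 0}"


section \<open>Dispersible classes\<close>

definition number_input :: "nat \<Rightarrow> nat \<Rightarrow> nat \<Rightarrow> state" where
  "number_input a b n = blank\<lparr>regs := (\<lambda>_. 0)(''a'' := a, ''b'' := b, ''n'' := n)\<rparr>"

definition out_fraction :: "state \<Rightarrow> real \<Rightarrow> bool" where
  "out_fraction s r \<longleftrightarrow> regs s ''den'' > 0 \<and> r = real (regs s ''num'') / real (regs s ''den'')"

definition bitlen :: "nat \<Rightarrow> real" where
  "bitlen k = log 2 (1 + real k)"

text \<open>Computability of \<open>\<delta>\<close> from \<open>\<gamma>\<close> and \<open>n\<close> in time polynomial in their binary encoding. A rational
  \<open>\<gamma> = a / b\<close> is an input of a single program that serves all rational \<open>\<gamma>\<close>. An irrational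
  \<open>\<gamma>\<close> cannot be written down as an input; it is a constant on which the program may depend.\<close>

definition poly_time_from_rational :: "(real \<Rightarrow> nat \<Rightarrow> real) \<Rightarrow> bool" where
  "poly_time_from_rational \<delta> \<longleftrightarrow> (\<exists>c (p :: real poly). \<forall>a b n. 0 < a \<and> 2 * a < b \<longrightarrow>
     (\<exists>T s. exec c (number_input a b n) T s \<and>
        real T \<le> poly p (bitlen a + bitlen b + bitlen n) \<and>
        out_fraction s (\<delta> (real a / real b) n)))"

definition poly_time_fixed :: "(nat \<Rightarrow> real) \<Rightarrow> bool" where
  "poly_time_fixed \<delta> \<longleftrightarrow> (\<exists>c (p :: real poly). \<forall>n.
     (\<exists>T s. exec c (number_input 0 0 n) T s \<and> real T \<le> poly p (bitlen n) \<and>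
        out_fraction s (\<delta> n)))"

definition poly2 :: "real poly poly \<Rightarrow> real \<Rightarrow> real \<Rightarrow> real" where
  "poly2 q x y = poly (poly q [:x:]) y"

text \<open>The function \<open>\<delta>\<close>, chosen depending on \<open>\<gamma>\<close>, is written as \<open>\<delta> \<gamma>\<close>; this permits to
  express that it is computable from \<open>\<gamma>\<close> and \<open>n\<close> by one program. The program that computes the
  disperser may depend on \<open>\<gamma>\<close>. For \<open>n = 0\<close> the library convention \<open>log 2 0 = 0\<close> is in force.
  The register \<open>m\<close> counts the output sets with repetition.\<close>

definition strongly_QP_dispersible :: "nat graph set \<Rightarrow> bool" where
  "strongly_QP_dispersible \<C> \<longleftrightarrow> hereditary \<C> \<and>
     (\<exists>(q :: real poly poly) (\<delta> :: real \<Rightarrow> nat \<Rightarrow> real).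
        poly_time_from_rational \<delta> \<and>
        (\<forall>\<gamma>. 0 < \<gamma> \<and> \<gamma> < 1 / 2 \<longrightarrow>
           antimono (\<delta> \<gamma>) \<and>
           (\<forall>n. 0 < \<delta> \<gamma> n \<and> \<delta> \<gamma> n < 1 / 2 \<and>
              inverse (\<delta> \<gamma> n) \<le> poly2 q (log 2 (real n)) (inverse \<gamma>)) \<and>
           poly_time_fixed (\<delta> \<gamma>) \<and>
           (\<exists>c. \<forall>n G w. G \<in> \<C> \<and> verts G = {..<n} \<longrightarrow>
              (\<exists>T s. exec c (weighted_graph_input G w) T s \<and>
                 real T \<le> 2 powr poly2 q (log 2 (real n)) (inverse \<gamma>) \<and>
                 real (regs s ''m'') \<le> 2 powr poly2 q (log 2 (real n)) (inverse \<gamma>) \<and>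
                 strong_disperser G w \<gamma> (\<delta> \<gamma> n) (out_family n s)))))"

text \<open>The bound on \<open>h\<close> says that the pattern graph, and thus the whole output, has polynomial
  size.\<close>

definition uniformly_dispersible :: "real \<Rightarrow> nat graph set \<Rightarrow> bool" where
  "uniformly_dispersible \<xi> \<C> \<longleftrightarrow> hereditary \<C> \<and>
     (\<exists>n0 > 0. \<exists>\<tau> > 0. \<exists>c (p :: real poly). \<forall>n G.
        G \<in> \<C> \<and> verts G = {..<n} \<and> connected_graph G \<and> n \<ge> n0 \<and>
        (\<forall>v\<in>verts G. real (card (closed_nbhd G v)) \<le> \<tau> * real n powr \<xi>) \<longrightarrow>
        (\<exists>T s. exec c (graph_input G) T s \<and>
           real T \<le> poly p (real n) \<and> real (regs s ''h'') \<le> poly p (real n) \<and>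
           uniform_disperser \<xi> G (out_set n s) (out_pattern s) (out_eta n s) (out_iota n s)))"

end

theory Submission
  imports Defs
begin

text \<open>Both parts rest on a separator found by following a Gyarfas path: as long as some component
  outside the closed neighbourhood of the path carries more than half of the weight, the path is
  prolonged into it. When no such component is left, the last \<open>T\<close> vertices of the path already
  suffice, because a heavy component that avoids their neighbourhood but sees an earlier vertex
  of the path would close an induced cycle through all of them.

  For the strong disperser, few vertices of the independent set \<open>I\<close> dominate all vertices whose
  neighbourhood meets a large fraction of \<open>I\<close>; their neighbourhoods avoid \<open>I\<close>, and the
  separator of the remaining graph is then light. Hence the neighbourhoods of all sets of
  \<open>O(\<gamma>\<^sup>-\<^sup>1 log n)\<close> vertices form a strong disperser, with \<open>\<delta> = 1 / 4\<close>. For the uniform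
  disperser, one searches the neighbourhoods of all sets of \<open>T\<close> vertices for one that leaves only
  components of at most half the size, and takes these components as the vertex sets of an
  edgeless pattern.\<close>

subsection \<open>Graphs and neighbourhoods\<close>

text \<open>What is deleted is an open neighbourhood N(S), never a closed one. The dominating
  vertices lie in I, and a single one of them may carry almost all of the weight, so they have to
  survive; once N(S) is gone they are isolated, and one-vertex components are exempt. Independence
  of I makes the neighbourhoods of the dominating vertices weightless, so only the at most T
  vertices of the separator cost anything, and after the domination each of them sees only a small
  fraction of I. As the candidate sets depend on G and \<gamma> alone, one family serves all weights
  and all I at once. The separator leaves at most 1/2 of the weight in a component, while \<delta>
  has to stay below 1/2; the constant 1/4 also makes \<delta> trivial to compute. For the uniform
  disperser, T neighbourhoods of size at most \<open>sqrt n / (2 * T)\<close> have together at most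
  \<open>sqrt n / 2\<close> vertices, which is exactly the budget if no atom has more than n/2
  vertices. The machine cannot take logarithms; a register is doubled until it exceeds n, and the
  family is enlarged at every doubling.\<close>

lemma adj_sym: "adj G u v \<longleftrightarrow> adj G v u"
  by (simp add: adj_def insert_commute)

lemma adj_irrefl: "simple_graph G \<Longrightarrow> \<not> adj G v v"
  by (auto simp: simple_graph_def adj_def)

lemma adj_verts: "simple_graph G \<Longrightarrow> adj G u v \<Longrightarrow> u \<in> verts G \<and> v \<in> verts G"
  by (auto simp: simple_graph_def adj_def)

lemma simple_graph_induced: "simple_graph G \<Longrightarrow> simple_graph (induced G S)"
  by (auto simp: simple_graph_def induced_def)

lemma verts_induced: "verts (induced G S) = verts G \<inter> S"
  by (simp add: induced_def)

lemma adj_induced: "adj (induced G S) u v \<longleftrightarrow> adj G u v \<and> u \<in> S \<and> v \<in> S"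
  by (auto simp: adj_def induced_def)

definition open_nbhd :: "'a graph \<Rightarrow> 'a set \<Rightarrow> 'a set" where
  "open_nbhd G S = {u. \<exists>v\<in>S. adj G u v}"

lemma open_nbhd_subset: "simple_graph G \<Longrightarrow> open_nbhd G S \<subseteq> verts G"
  by (auto simp: open_nbhd_def dest: adj_verts)

lemma open_nbhd_Un: "open_nbhd G (S \<union> T) = open_nbhd G S \<union> open_nbhd G T"
  by (auto simp: open_nbhd_def)

subsection \<open>Connected sets\<close>

text \<open>Connectivity is phrased for vertex sets of one fixed graph, so that the separator
  argument can shrink and enlarge sets without passing to other graphs.\<close>

definition adj_in :: "'a graph \<Rightarrow> 'a set \<Rightarrow> ('a \<times> 'a) set" where
  "adj_in G W = {(u, v). u \<in> W \<and> v \<in> W \<and> adj G u v}"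

definition connected_within :: "'a graph \<Rightarrow> 'a set \<Rightarrow> bool" where
  "connected_within G C \<longleftrightarrow> (\<forall>a\<in>C. \<forall>b\<in>C. (a, b) \<in> (adj_in G C)\<^sup>*)"

lemma adj_in_mono: "A \<subseteq> B \<Longrightarrow> adj_in G A \<subseteq> adj_in G B"
  by (auto simp: adj_in_def)

lemma adj_in_rtrancl_sym: "(a, b) \<in> (adj_in G W)\<^sup>* \<Longrightarrow> (b, a) \<in> (adj_in G W)\<^sup>*"
proof -
  have "sym (adj_in G W)"
    by (auto simp: sym_def adj_in_def adj_sym)
  then show "(a, b) \<in> (adj_in G W)\<^sup>* \<Longrightarrow> (b, a) \<in> (adj_in G W)\<^sup>*"
    by (meson sym_rtrancl symD)
qed

lemma connected_within_insert:
  assumes "connected_within G D" "y \<in> D" "adj G x y"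
  shows "connected_within G (insert x D)"
proof -
  let ?R = "(adj_in G (insert x D))\<^sup>*"
  have "(y, b) \<in> ?R" if "b \<in> insert x D" for b
  proof (cases "b = x")
    case True
    have "(y, x) \<in> adj_in G (insert x D)"
      using assms adj_sym[of G] by (auto simp: adj_in_def)
    then show ?thesis using True by auto
  next
    case False
    then have "(y, b) \<in> (adj_in G D)\<^sup>*"
      using assms that by (auto simp: connected_within_def)
    then show ?thesis
      using rtrancl_mono[OF adj_in_mono[of D "insert x D" G]] by blast
  qed
  then show ?thesis
    unfolding connected_within_def by (meson adj_in_rtrancl_sym rtrancl_trans)
qed

text \<open>A walk from \<open>a\<close> to \<open>b\<close> inside \<open>S\<close> has to leave
  \<open>D\<close> at some step.\<close>

lemma connected_within_crossing:
  assumes "connected_within G S" "a \<in> S" "a \<in> D" "b \<in> S" "b \<notin> D"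
  obtains x y where "x \<in> S" "x \<notin> D" "y \<in> S" "y \<in> D" "adj G x y"
proof -
  have "(a, b) \<in> (adj_in G S)\<^sup>*"
    using assms by (auto simp: connected_within_def)
  then have "b \<in> D \<or> (\<exists>x y. x \<in> S \<and> x \<notin> D \<and> y \<in> S \<and> y \<in> D \<and> adj G x y)"
  proof (induction rule: rtrancl_induct)
    case base
    then show ?case using assms by simp
  next
    case (step y z)
    then show ?case by (auto simp: adj_in_def) (metis adj_sym)
  qed
  then show ?thesis using assms that by blast
qed

definition component_within :: "'a graph \<Rightarrow> 'a set \<Rightarrow> 'a \<Rightarrow> 'a set" where
  "component_within G W c = {u. (c, u) \<in> (adj_in G W)\<^sup>*}"

lemma component_within_refl: "c \<in> component_within G W c"
  by (simp add: component_within_def)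

lemma component_within_subset:
  assumes "c \<in> W" shows "component_within G W c \<subseteq> W"
proof
  fix u assume "u \<in> component_within G W c"
  then have "(c, u) \<in> (adj_in G W)\<^sup>*" by (simp add: component_within_def)
  then show "u \<in> W" using assms
    by (induction rule: rtrancl_induct) (auto simp: adj_in_def)
qed

lemma connected_within_component: "connected_within G (component_within G W c)"
proof -
  let ?C = "component_within G W c"
  have *: "(c, u) \<in> (adj_in G ?C)\<^sup>*" if "(c, u) \<in> (adj_in G W)\<^sup>*" for u
    using that
  proof (induction rule: rtrancl_induct)
    case base
    then show ?case by simp
  next
    case (step y z)
    then have "(y, z) \<in> adj_in G ?C"
      by (auto simp: adj_in_def component_within_def intro: rtrancl_into_rtrancl)
    with step show ?case by simp
  qed
  show ?thesis
    unfolding connected_within_def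
  proof (intro ballI)
    fix a b assume "a \<in> ?C" "b \<in> ?C"
    then have "(c, a) \<in> (adj_in G ?C)\<^sup>*" "(c, b) \<in> (adj_in G ?C)\<^sup>*"
      using *[of a] *[of b] unfolding component_within_def[of G W c] by auto
    then show "(a, b) \<in> (adj_in G ?C)\<^sup>*"
      using adj_in_rtrancl_sym rtrancl_trans by metis
  qed
qed

text \<open>Maximality of components. It is mostly applied in contraposition: a vertex outside the
  component that sees it must lie outside \<open>W\<close>, which locates the boundary of the
  component.\<close>

lemma component_within_closed:
  "\<lbrakk>c \<in> W; x \<in> W; y \<in> component_within G W c; adj G x y\<rbrakk> \<Longrightarrow> x \<in> component_within G W c"
  using component_within_subset[of c W G]
  by (auto simp: component_within_def adj_in_def adj_sym[of G x y] intro: rtrancl_into_rtrancl)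

lemma connected_within_subset_component:
  assumes "connected_within G C" "C \<subseteq> W" "c \<in> C" "c' \<in> C" "c \<in> component_within G W d"
  shows "c' \<in> component_within G W d"
proof -
  have "(c, c') \<in> (adj_in G W)\<^sup>*"
    using assms rtrancl_mono[OF adj_in_mono[of C W G]] by (auto simp: connected_within_def)
  then show ?thesis using assms by (auto simp: component_within_def)
qed

subsection \<open>Induced paths and cycles\<close>

primrec induced_path :: "'a graph \<Rightarrow> 'a list \<Rightarrow> bool" where
  "induced_path G [] \<longleftrightarrow> True"
| "induced_path G (x # p) \<longleftrightarrow> induced_path G p \<and> x \<notin> set p \<and>
     (p \<noteq> [] \<longrightarrow> adj G x (hd p)) \<and> (\<forall>z\<in>set (tl p). \<not> adj G x z)"

lemma induced_path_appendD1: "induced_path G (p @ q) \<Longrightarrow> induced_path G p"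
proof (induction p)
  case (Cons a p)
  have "induced_path G p" using Cons by simp
  with Cons.prems show ?case by (cases p) auto
qed simp

lemma induced_path_appendD2: "induced_path G (p @ q) \<Longrightarrow> induced_path G q"
  by (induction p) auto

lemma induced_path_join:
  assumes "induced_path G (p @ [v])" "induced_path G (v # q)"
    "\<forall>a\<in>set p. \<forall>b\<in>set q. a \<noteq> b \<and> \<not> adj G a b"
  shows "induced_path G (p @ v # q)"
  using assms
proof (induction p)
  case (Cons a p)
  have "induced_path G (p @ v # q)" using Cons.IH Cons.prems by simp
  moreover have "hd (p @ v # q) = hd (p @ [v])"
    and "set (tl (p @ v # q)) = set (tl (p @ [v])) \<union> set q" by (cases p; simp)+
  ultimately show ?case using Cons.prems by auto
qed simp

lemma induced_path_distinct: "induced_path G p \<Longrightarrow> distinct p"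
  by (induction p) auto

lemma induced_path_nth:
  assumes "induced_path G p" "i < j" "j < length p"
  shows "adj G (p ! i) (p ! j) \<longleftrightarrow> j = Suc i"
  using assms
proof (induction p arbitrary: i j)
  case (Cons x p)
  show ?case
  proof (cases i)
    case 0
    from Cons.prems obtain k where k: "j = Suc k" "k < length p"
      by (cases j) auto
    show ?thesis
    proof (cases k)
      case 0
      then show ?thesis using Cons.prems k \<open>i = 0\<close> by (auto simp: hd_conv_nth)
    next
      case (Suc l)
      then have "p ! k \<in> set (tl p)"
        using k by (cases p) auto
      then show ?thesis using Cons.prems k Suc \<open>i = 0\<close> by auto
    qed
  next
    case (Suc i')
    with Cons.prems obtain k where k: "j = Suc k" "k < length p" "i' < k"
      by (cases j) auto
    then show ?thesis using Cons Suc by auto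
  qed
qed simp

text \<open>No shortest path is chosen. The walk is absorbed backwards: a new vertex that already
  lies on the induced path cuts off everything before it, and any other one is linked to its last
  neighbour on the path, so that no chord survives.\<close>

lemma connected_within_induced_path:
  assumes "connected_within G S" "a \<in> S" "b \<in> S"
  obtains p where "induced_path G p" "p \<noteq> []" "hd p = a" "last p = b" "set p \<subseteq> S"
proof -
  have "(a, b) \<in> (adj_in G S)\<^sup>*"
    using assms by (auto simp: connected_within_def)
  then have "\<exists>p. induced_path G p \<and> p \<noteq> [] \<and> hd p = a \<and> last p = b \<and> set p \<subseteq> S"
  proof (induction rule: converse_rtrancl_induct)
    case base
    then show ?case using assms by (intro exI[of _ "[b]"]) auto
  next
    case (step y z)
    then obtain p where p: "induced_path G p" "p \<noteq> []" "hd p = z" "last p = b" "set p \<subseteq> S"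
      by blast
    have yz: "y \<in> S" "adj G y z" using step by (auto simp: adj_in_def)
    show ?case
    proof (cases "y \<in> set p")
      case True
      then obtain us vs where "p = us @ y # vs" by (meson split_list)
      with p show ?thesis
        by (intro exI[of _ "y # vs"]) (auto dest: induced_path_appendD2)
    next
      case False
      have "\<exists>u\<in>set p. adj G y u" using p yz by (metis hd_in_set)
      then obtain us u vs where split: "p = us @ u # vs" "adj G y u" "\<forall>v\<in>set vs. \<not> adj G y v"
        using split_list_last_prop[of p "adj G y"] by blast
      have "induced_path G (u # vs)" using p split by (auto dest: induced_path_appendD2)
      then show ?thesis
        using p split False yz by (intro exI[of _ "y # u # vs"]) auto
    qed
  qed
  then show ?thesis using that by blast
qed

section \<open>Closing an induced path to an induced cycle\<close>

lemma adj_cycle_graph: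
  assumes "i < j" "j < l"
  shows "adj (cycle_graph l) i j \<longleftrightarrow> j = Suc i \<or> (i = 0 \<and> Suc j = l)"
proof
  assume "adj (cycle_graph l) i j"
  then obtain a where a: "{i, j} = {a, Suc a mod l}" "a < l"
    by (auto simp: adj_def cycle_graph_def)
  show "j = Suc i \<or> (i = 0 \<and> Suc j = l)"
  proof (cases "Suc a = l")
    case True
    then show ?thesis using a assms by (auto simp: doubleton_eq_iff)
  next
    case False
    then have "Suc a mod l = Suc a" using a by simp
    then show ?thesis using a assms by (auto simp: doubleton_eq_iff)
  qed
next
  assume "j = Suc i \<or> (i = 0 \<and> Suc j = l)"
  then show "adj (cycle_graph l) i j"
  proof
    assume "j = Suc i"
    then show ?thesis using assms
      by (auto simp: adj_def cycle_graph_def intro!: exI[of _ i])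
  next
    assume "i = 0 \<and> Suc j = l"
    then show ?thesis using assms
      by (auto simp: adj_def cycle_graph_def intro!: exI[of _ j])
  qed
qed

lemma has_induced_cycleI:
  assumes G: "simple_graph G" and p: "induced_path G p" "set p \<subseteq> verts G" "p \<noteq> []"
    and x: "x \<in> verts G" "x \<notin> set p" "adj G x (hd p)" "adj G x (last p)"
      "\<forall>z\<in>set (butlast (tl p)). \<not> adj G x z"
  shows "has_induced G (cycle_graph (Suc (length p)))"
proof -
  define c where "c = x # p"
  define l where "l = length c"
  have dist: "distinct c" using p x induced_path_distinct[of G p] by (simp add: c_def)
  have less: "adj G (c ! i) (c ! j) \<longleftrightarrow> adj (cycle_graph l) i j" if ij: "i < j" "j < l" for i j
  proof (cases i)
    case 0
    from ij obtain k where k: "j = Suc k" "k < length p"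
      by (cases j) (auto simp: l_def c_def)
    consider "k = 0" | "Suc k = length p" | "0 < k" "Suc k < length p" using k by linarith
    then have "adj G x (p ! k) \<longleftrightarrow> k = 0 \<or> Suc k = length p"
    proof cases
      case 1
      then show ?thesis using x p by (simp add: hd_conv_nth)
    next
      case 2
      then have "p ! k = last p" using p by (metis diff_Suc_1 last_conv_nth)
      then show ?thesis using x 2 by simp
    next
      case 3
      then have "p ! k = butlast (tl p) ! (k - 1)"
        by (simp add: nth_butlast nth_tl)
      moreover have "butlast (tl p) ! (k - 1) \<in> set (butlast (tl p))"
        using 3 by (intro nth_mem) auto
      ultimately show ?thesis using x 3 by auto
    qed
    then show ?thesis using adj_cycle_graph[OF ij] 0 k by (auto simp: c_def l_def)
  next
    case (Suc i')
    from ij obtain k where k: "j = Suc k" "k < length p"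
      by (cases j) (auto simp: l_def c_def)
    then show ?thesis
      using adj_cycle_graph[OF ij] induced_path_nth[OF p(1), of i' k] Suc ij
      by (auto simp: c_def)
  qed
  \<comment> \<open>\<open>cycle_graph 1\<close> has the degenerate edge \<open>{0}\<close>; the
    nonempty path excludes it by giving \<open>l \<ge> 2\<close>.\<close>
  have loop: "\<not> adj (cycle_graph l) i i" if "i < l" for i
  proof
    assume "adj (cycle_graph l) i i"
    then obtain a where a: "{i} = {a, Suc a mod l}" "a < l"
      by (auto simp: adj_def cycle_graph_def)
    then have eq: "Suc a mod l = a" by auto
    have "l \<ge> 2" using p by (cases p) (auto simp: l_def c_def)
    show False
    proof (cases "Suc a = l")
      case True
      with eq \<open>l \<ge> 2\<close> show False by auto
    next
      case False
      with eq a show False by auto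
    qed
  qed
  have adj_c: "adj G (c ! i) (c ! j) \<longleftrightarrow> adj (cycle_graph l) i j" if "i < l" "j < l" for i j
    using less[of i j] less[of j i] loop[of i] adj_irrefl[OF G] that
    by (cases i j rule: linorder_cases) (auto simp: adj_sym)
  define f where "f = inv_into {..<l} ((!) c)"
  have bij: "bij_betw ((!) c) {..<l} (set c)"
    using dist by (auto simp: l_def intro: bij_betw_nth)
  have fc: "f (c ! i) = i" if "i < l" for i
    using that bij by (simp add: f_def bij_betw_inv_into_left)
  have "bij_betw f (set c) {..<l}"
    using bij by (simp add: f_def bij_betw_inv_into)
  moreover have "verts (induced G (set c)) = set c"
    using p x by (auto simp: verts_induced c_def)
  moreover have "adj (induced G (set c)) u v \<longleftrightarrow> adj (cycle_graph l) (f u) (f v)"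
    if "u \<in> set c" "v \<in> set c" for u v
    using that fc adj_c by (auto simp: adj_induced in_set_conv_nth l_def)
  ultimately have "isomorphic (induced G (set c)) (cycle_graph l)"
    by (auto simp: isomorphic_def cycle_graph_def)
  moreover have "set c \<subseteq> verts G" using p x by (simp add: c_def)
  moreover have "l = Suc (length p)" by (simp add: l_def c_def)
  ultimately show ?thesis unfolding has_induced_def by blast
qed

subsection \<open>Separators dominated by few vertices\<close>

lemma sum_Int_nonempty:
  fixes w :: "'a \<Rightarrow> nat"
  assumes "finite V" "A \<subseteq> V" "B \<subseteq> V" "sum w V < 2 * sum w A" "sum w V < 2 * sum w B"
  shows "A \<inter> B \<noteq> {}"
proof
  assume "A \<inter> B = {}"
  then have "sum w A + sum w B = sum w (A \<union> B)"
    using assms by (metis finite_subset sum.union_disjoint)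
  also have "\<dots> \<le> sum w V" using assms by (intro sum_mono2) auto
  finally show False using assms by simp
qed

text \<open>The list \<open>vs\<close> is a Gyarfas path, the most recent vertex first, and \<open>D\<close> is the heavy component
  of the graph without the closed neighbourhood of all its vertices but the most recent one.\<close>

lemma separator_step:
  fixes w :: "'a \<Rightarrow> nat"
  assumes G: "simple_graph G" and V: "V \<subseteq> verts G"
    and free: "\<And>l. l \<ge> T \<Longrightarrow> \<not> has_induced G (cycle_graph l)" and T: "T \<ge> 1"
  shows "\<lbrakk>vs \<noteq> []; set vs \<subseteq> V; induced_path G vs; D \<subseteq> V; connected_within G D;
      connected_within G (insert (hd vs) D);
      D \<inter> (set (tl vs) \<union> open_nbhd G (set (tl vs))) = {}; sum w V < 2 * sum w D;
      \<forall>x\<in>V - D. \<forall>y\<in>D. adj G x y \<longrightarrow> x \<in> set (tl vs) \<union> open_nbhd G (set (tl vs))\<rbrakk> \<Longrightarrow>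
    \<exists>Q\<subseteq>V. card Q \<le> T \<and>
      (\<forall>C. C \<subseteq> V - Q - open_nbhd G Q \<longrightarrow> connected_within G C \<longrightarrow> 2 * sum w C \<le> sum w V)"
proof (induction "card D" arbitrary: vs D rule: less_induct)
  case less
  note vs = \<open>set vs \<subseteq> V\<close> \<open>induced_path G vs\<close>
  note D = \<open>D \<subseteq> V\<close> \<open>connected_within G D\<close> \<open>connected_within G (insert (hd vs) D)\<close>
    \<open>sum w V < 2 * sum w D\<close>
  note disj = \<open>D \<inter> (set (tl vs) \<union> open_nbhd G (set (tl vs))) = {}\<close>
  note closed = \<open>\<forall>x\<in>V - D. \<forall>y\<in>D. adj G x y \<longrightarrow> x \<in> set (tl vs) \<union> open_nbhd G (set (tl vs))\<close>
  obtain v vs' where vs_eq: "vs = v # vs'" using \<open>vs \<noteq> []\<close> by (cases vs) auto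
  have fin: "finite V" using G V finite_subset by (auto simp: simple_graph_def)
  show ?case
  proof (cases "\<exists>C. C \<subseteq> V - set vs - open_nbhd G (set vs) \<and> connected_within G C \<and>
      sum w V < 2 * sum w C")
    case True
    define W where "W = V - set vs - open_nbhd G (set vs)"
    from True obtain C where C: "C \<subseteq> W" "connected_within G C" "sum w V < 2 * sum w C"
      by (auto simp: W_def)
    have "C \<inter> D \<noteq> {}"
      using sum_Int_nonempty[OF fin, of C D w] C D by (auto simp: W_def)
    then obtain c where c: "c \<in> C" "c \<in> D" by blast
    define D' where "D' = component_within G W c"
    have cW: "c \<in> W" using c C by blast
    have D'W: "D' \<subseteq> W" unfolding D'_def by (rule component_within_subset[OF cW])
    have connD': "connected_within G D'" unfolding D'_def by (rule connected_within_component)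
    have cD': "c \<in> D'" unfolding D'_def by (rule component_within_refl)
    have CD': "C \<subseteq> D'"
      using connected_within_subset_component[OF C(2,1) c(1)] cD' by (auto simp: D'_def)
    \<comment> \<open>Whatever sees \<open>D\<close> from outside lies in the closed neighbourhood
      of the older path vertices, which \<open>W\<close> avoids; so \<open>D'\<close> cannot leave
      \<open>D\<close>.\<close>
    have D'D: "D' \<subseteq> D"
    proof
      fix d assume d: "d \<in> D'"
      show "d \<in> D"
      proof (rule ccontr)
        assume "d \<notin> D"
        then obtain x y where "x \<in> D'" "x \<notin> D" "y \<in> D'" "y \<in> D" "adj G x y"
          using connected_within_crossing[OF connD' cD' c(2) d] by blast
        then show False using closed D'W vs_eq by (auto simp: W_def open_nbhd_def)
      qed
    qed
    have vD': "v \<notin> D'" using D'W vs_eq by (auto simp: W_def)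
    \<comment> \<open>The next path vertex is the place where a walk from \<open>D'\<close> to
      \<open>v\<close> through \<open>D\<close> leaves \<open>D'\<close>. It is not in
      \<open>W\<close> because \<open>D'\<close> is a component of \<open>W\<close>, and it does not
      see the older vertices because it is in \<open>D\<close>; hence it is adjacent to
      \<open>v\<close> and to no other path vertex. It also leaves the heavy component, so
      \<open>card D\<close> drops.\<close>
    obtain y z where y: "y \<in> insert v D" "y \<notin> D'" and z: "z \<in> D'" "adj G y z"
      using connected_within_crossing[of G "insert v D" c D' v] D(3) cD' c(2) vD' vs_eq
      by (metis insertI1 insertI2 list.sel(1))
    have "y \<noteq> v" using z D'W vs_eq adj_sym[of G] by (auto simp: W_def open_nbhd_def)
    then have yD: "y \<in> D" using y by simp
    have "y \<notin> W" using component_within_closed[OF cW] z y by (auto simp: D'_def)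
    then have yv: "adj G y v"
      using yD D(1) disj \<open>y \<noteq> v\<close> vs_eq by (auto simp: W_def open_nbhd_def)
    have path: "induced_path G (y # vs)"
      using vs vs_eq \<open>y \<noteq> v\<close> yv yD disj by (auto simp: open_nbhd_def)
    have "card D' < card D"
      using D'D y yD D(1) fin by (metis finite_subset psubsetI psubset_card_mono)
    moreover have "sum w V < 2 * sum w D'"
    proof -
      have "sum w C \<le> sum w D'"
        using CD' D'D D(1) fin by (meson finite_subset sum_mono2 zero_le)
      then show ?thesis using C by simp
    qed
    moreover have "\<forall>x\<in>V - D'. \<forall>u\<in>D'. adj G x u \<longrightarrow> x \<in> set vs \<union> open_nbhd G (set vs)"
    proof (intro ballI impI)
      fix x u assume x: "x \<in> V - D'" "u \<in> D'" "adj G x u"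
      then have "x \<notin> W" using component_within_closed[OF cW, of x u G] by (auto simp: D'_def)
      then show "x \<in> set vs \<union> open_nbhd G (set vs)" using x by (auto simp: W_def)
    qed
    moreover have "connected_within G (insert y D')"
      using connected_within_insert[OF connD' z] .
    moreover have "D' \<inter> (set vs \<union> open_nbhd G (set vs)) = {}"
      using D'W by (auto simp: W_def)
    moreover have "set (y # vs) \<subseteq> V" using vs(1) yD D(1) by auto
    moreover have "D' \<subseteq> V" using D'D D(1) by blast
    ultimately show ?thesis
      using path connD' by (intro less.hyps[of D' "y # vs"]) simp_all
  next
    case False
    \<comment> \<open>The head of \<open>vs\<close> is the newest vertex, so these are the last
      \<open>T\<close> vertices of the path.\<close>
    define Q where "Q = set (take T vs)"
    have "2 * sum w C \<le> sum w V"
      if C: "C \<subseteq> V - Q - open_nbhd G Q" "connected_within G C" for C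
    proof (rule ccontr)
      assume "\<not> ?thesis"
      then have heavy: "sum w V < 2 * sum w C" by simp
      have vQ: "v \<in> Q" using vs_eq T by (cases T) (auto simp: Q_def)
      have "C \<inter> D \<noteq> {}"
        using sum_Int_nonempty[OF fin, of C D w] C D heavy by auto
      then obtain c where c: "c \<in> C" "c \<in> D" by blast
      \<comment> \<open>Inside \<open>D\<close> the set \<open>C\<close> would avoid the closed
        neighbourhood of the whole path: that of the older vertices since \<open>D\<close> does,
        that of \<open>v\<close> since \<open>v\<close> is in \<open>Q\<close>. Then the path could
        be prolonged.\<close>
      have "\<not> C \<subseteq> D"
      proof
        assume "C \<subseteq> D"
        then have "C \<subseteq> V - set vs - open_nbhd G (set vs)"
          using C(1) disj vQ vs_eq by (auto simp: open_nbhd_def)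
        then show False using False C heavy by blast
      qed
      then obtain x y where x: "x \<in> C" "x \<notin> D" and y: "y \<in> D" "adj G x y"
        using connected_within_crossing[OF C(2) c] by blast
      have xV: "x \<in> V" "x \<notin> Q" and xQ: "\<not> (\<exists>u\<in>Q. adj G x u)"
        using x C by (auto simp: open_nbhd_def)
      have "x \<notin> set vs'"
        using y disj vs_eq adj_sym[of G x y] by (auto simp: open_nbhd_def)
      then have "x \<in> open_nbhd G (set vs')" and xvs: "x \<notin> set vs"
        using closed xV x y vQ vs_eq by auto
      then have "\<exists>u\<in>set vs. adj G x u" using vs_eq by (auto simp: open_nbhd_def)
      \<comment> \<open>\<open>z\<close> is the newest path vertex seen by \<open>x\<close>. As
        \<open>x\<close> sees nothing of \<open>Q\<close>, at least \<open>T\<close> vertices are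
        newer than \<open>z\<close>.\<close>
      then obtain ys z zs where split: "vs = ys @ z # zs" "adj G x z" "\<forall>u\<in>set ys. \<not> adj G x u"
        using split_list_first_prop[of vs "adj G x"] by blast
      have len: "length ys \<ge> T"
      proof (rule ccontr)
        assume "\<not> length ys \<ge> T"
        then have "z \<in> set (take T vs)"
          using split(1) by (auto simp: take_Cons' )
        then show False using xQ split by (auto simp: Q_def)
      qed
      then obtain ys' where ys: "ys = v # ys'" using T split(1) vs_eq by (cases ys) auto
      have conn: "connected_within G (insert x (insert v D))"
        using connected_within_insert[of G "insert v D" y x] D(3) y vs_eq by simp
      obtain p where p: "induced_path G p" "p \<noteq> []" "hd p = x" "last p = v"
          "set p \<subseteq> insert x (insert v D)"
        by (rule connected_within_induced_path[OF conn, of x v]) auto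
      have "x \<noteq> v" using xV vQ by auto
      then obtain p'' where p'': "p = x # p'' @ [v]"
        using p by (metis append_butlast_last_id hd_Cons_tl last_ConsL last_tl)
      have p''D: "set p'' \<subseteq> D"
        using p p'' induced_path_distinct[OF p(1)] by auto
      have vs'_eq: "vs' = ys' @ z # zs" using split(1) vs_eq ys by simp
      \<comment> \<open>From \<open>x\<close> through \<open>D\<close> to the head \<open>v\<close>,
        then back along the path to \<open>z\<close>, which sees \<open>x\<close> again. The part in
        \<open>D\<close> has no edges to the older path vertices, so the closed walk is an induced
        cycle; it contains \<open>x\<close>, \<open>z\<close> and all of \<open>ys\<close>, hence
        has more than \<open>T\<close> vertices.\<close>
      define P where "P = p'' @ v # (ys' @ [z])"
      have "induced_path G P" unfolding P_def
      proof (rule induced_path_join)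
        show "induced_path G (p'' @ [v])" using p(1) p'' by simp
        show "induced_path G (v # ys' @ [z])"
          using vs(2) split(1) ys induced_path_appendD1[of G "v # ys' @ [z]" zs] by simp
        show "\<forall>a\<in>set p''. \<forall>b\<in>set (ys' @ [z]). a \<noteq> b \<and> \<not> adj G a b"
          using p''D disj vs_eq vs'_eq by (auto simp: open_nbhd_def)
      qed
      moreover have "set P \<subseteq> verts G"
        using p''D D(1) V vs(1) vs_eq vs'_eq by (auto simp: P_def)
      moreover have "x \<notin> set P"
        using xvs p(1) p'' vs_eq vs'_eq by (auto simp: P_def)
      moreover have "adj G x (hd P)"
        using p(1) p'' by (cases p'') (auto simp: P_def)
      moreover have "adj G x (last P)" using split by (simp add: P_def)
      moreover have "\<forall>u\<in>set (butlast (tl P)). \<not> adj G x u"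
      proof -
        have "P = (p'' @ [v]) @ ys' @ [z]" by (simp add: P_def)
        then have "butlast (tl P) = tl (p'' @ [v]) @ ys'"
          by (cases p'') (auto simp: butlast_append)
        then show ?thesis using p(1) p'' split ys by auto
      qed
      moreover have "P \<noteq> []" "x \<in> verts G" using xV V by (auto simp: P_def)
      ultimately have "has_induced G (cycle_graph (Suc (length P)))"
        by (intro has_induced_cycleI[OF G, of P x])
      then show False using free[of "Suc (length P)"] len ys by (auto simp: P_def)
    qed
    moreover have "card Q \<le> T"
      by (metis Q_def card_length length_take min.bounded_iff)
    moreover have "Q \<subseteq> V" using vs by (metis Q_def dual_order.trans set_take_subset)
    ultimately show ?thesis by blast
  qed
qed

text \<open>The path starts as a single vertex \<open>c\<close> of a heavy component of
  \<open>V\<close>; there are no older vertices yet, so the invariant only asks that component to be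
  closed in \<open>V\<close>. The set \<open>V\<close> is arbitrary because the strong disperser
  applies the separator to what remains after the domination.\<close>

lemma separator:
  fixes w :: "'a \<Rightarrow> nat"
  assumes G: "simple_graph G" and V: "V \<subseteq> verts G"
    and free: "\<And>l. l \<ge> T \<Longrightarrow> \<not> has_induced G (cycle_graph l)" and T: "T \<ge> 1"
  obtains Q where "Q \<subseteq> V" "card Q \<le> T"
    "\<And>C. C \<subseteq> V - Q - open_nbhd G Q \<Longrightarrow> connected_within G C \<Longrightarrow> 2 * sum w C \<le> sum w V"
proof (cases "\<exists>C\<subseteq>V. connected_within G C \<and> sum w V < 2 * sum w C")
  case True
  then obtain C where C: "C \<subseteq> V" "connected_within G C" "sum w V < 2 * sum w C" by blast
  then obtain c where c: "c \<in> C" by fastforce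
  define D where "D = component_within G V c"
  have cV: "c \<in> V" using c C by blast
  have DV: "D \<subseteq> V" unfolding D_def by (rule component_within_subset[OF cV])
  have conn: "connected_within G D" unfolding D_def by (rule connected_within_component)
  have cD: "c \<in> D" unfolding D_def by (rule component_within_refl)
  have CD: "C \<subseteq> D"
    using connected_within_subset_component[OF C(2,1) c] cD by (auto simp: D_def)
  have "finite V" using G V finite_subset by (auto simp: simple_graph_def)
  then have "sum w C \<le> sum w D"
    using CD DV by (meson finite_subset sum_mono2 zero_le)
  then have "sum w V < 2 * sum w D" using C by simp
  moreover have "\<forall>x\<in>V - D. \<forall>y\<in>D. \<not> adj G x y"
    using component_within_closed[OF cV] by (auto simp: D_def)
  ultimately have "\<exists>Q\<subseteq>V. card Q \<le> T \<and>
      (\<forall>C. C \<subseteq> V - Q - open_nbhd G Q \<longrightarrow> connected_within G C \<longrightarrow> 2 * sum w C \<le> sum w V)"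
    using DV conn cD
    by (intro separator_step[OF G V free T, of "[c]" D w]) (auto simp: open_nbhd_def insert_absorb)
  then show ?thesis using that by blast
next
  case False
  show ?thesis
  proof (rule that[of "{}"])
    show "2 * sum w C \<le> sum w V"
      if "C \<subseteq> V - {} - open_nbhd G {}" "connected_within G C" for C
      using False that by (auto simp: not_less open_nbhd_def)
  qed auto
qed

subsection \<open>Components outside a neighbourhood\<close>

lemma component_of_delete_verts:
  "component_of (delete_verts G X) v = component_within G (verts G - X) v"
proof -
  have "{(x, y). adj (delete_verts G X) x y} = adj_in G (verts G - X)"
    by (auto simp: adj_in_def delete_verts_def adj_induced)
  then show ?thesis by (simp add: component_of_def component_within_def)
qed

lemma components_delete_verts:
  assumes "C \<in> components (delete_verts G X)"
  shows "C \<subseteq> verts G - X" "C \<noteq> {}" "connected_within G C"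
proof -
  obtain v where v: "v \<in> verts G - X" "C = component_within G (verts G - X) v"
  proof -
    have "verts (delete_verts G X) = verts G - X"
      by (auto simp: delete_verts_def verts_induced)
    then show ?thesis
      using assms that by (auto simp: components_def component_of_delete_verts)
  qed
  show "C \<subseteq> verts G - X" using v component_within_subset[of v "verts G - X" G] by simp
  show "C \<noteq> {}" using v component_within_refl[of v G] by auto
  show "connected_within G C" using v connected_within_component by metis
qed

text \<open>Deleting only the open neighbourhood leaves the vertices of \<open>S\<close> isolated, so that one loses
  nothing compared with deleting the closed neighbourhood.\<close>

lemma connected_within_outside_open_nbhd:
  assumes "connected_within G C" "C \<inter> open_nbhd G S = {}" "C \<noteq> {}" "\<not> is_singleton C"
  shows "C \<inter> S = {}"
proof (rule ccontr)
  assume "C \<inter> S \<noteq> {}"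
  then obtain s where s: "s \<in> C" "s \<in> S" by blast
  have "C \<noteq> {s}" using assms by auto
  then obtain b where b: "b \<in> C" "b \<notin> {s}" using s by blast
  obtain x where "x \<in> C" "adj G x s"
    using connected_within_crossing[OF assms(1) s(1) _ b] by blast
  then show False using s assms(2) by (auto simp: open_nbhd_def)
qed

subsection \<open>Covering the vertices with heavy neighbourhoods\<close>

lemma closed_nbhd_sym:
  "u \<in> verts G \<Longrightarrow> v \<in> verts G \<Longrightarrow> u \<in> closed_nbhd G v \<longleftrightarrow> v \<in> closed_nbhd G u"
  by (auto simp: closed_nbhd_def adj_sym)

text \<open>Averaging: if \<open>u\<close> is drawn from \<open>I\<close> with probability
  proportional to its weight, each vertex of \<open>H\<close> is dominated by \<open>u\<close> with
  probability at least \<beta>, so some \<open>u\<close> dominates at least the fraction \<beta> of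
  \<open>H\<close>. The proof is the corresponding double count.\<close>

lemma vertex_covering_fraction:
  fixes w :: "'a \<Rightarrow> nat" and \<beta> :: real
  assumes fin: "finite (verts G)" and I: "I \<subseteq> verts G" "sum w I > 0" and H: "H \<subseteq> verts G"
    and heavy: "\<And>v. v \<in> H \<Longrightarrow> \<beta> * real (sum w I) \<le> real (sum w (I \<inter> closed_nbhd G v))"
  obtains u where "u \<in> I" "\<beta> * real (card H) \<le> real (card (H \<inter> closed_nbhd G u))"
proof -
  have finI: "finite I" and finH: "finite H" using fin I H finite_subset by auto
  have "\<exists>u\<in>I. \<beta> * real (card H) \<le> real (card (H \<inter> closed_nbhd G u))"
  proof (rule ccontr)
    assume "\<not> ?thesis"
    then have light: "real (card (H \<inter> closed_nbhd G u)) < \<beta> * real (card H)" if "u \<in> I" for u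
      using that by auto
    have "\<exists>u\<in>I. 0 < w u" using I by (metis finI gr0I sum.neutral less_irrefl)
    then obtain u0 where u0: "u0 \<in> I" "0 < w u0" by blast
    have "\<beta> * real (sum w I) * real (card H) = (\<Sum>v\<in>H. \<beta> * real (sum w I))" by simp
    also have "\<dots> \<le> (\<Sum>v\<in>H. real (sum w (I \<inter> closed_nbhd G v)))"
      by (intro sum_mono heavy)
    also have "\<dots> = (\<Sum>v\<in>H. \<Sum>u\<in>I. if u \<in> closed_nbhd G v then real (w u) else 0)"
      by (auto simp: sum.inter_restrict finI intro!: sum.cong)
    also have "\<dots> = (\<Sum>u\<in>I. \<Sum>v\<in>H. if v \<in> closed_nbhd G u then real (w u) else 0)"
    proof (subst sum.swap, intro sum.cong refl)
      fix u v assume "u \<in> I" "v \<in> H"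
      then have "u \<in> closed_nbhd G v \<longleftrightarrow> v \<in> closed_nbhd G u"
        using closed_nbhd_sym[of u G v] I H by auto
      then show "(if u \<in> closed_nbhd G v then real (w u) else 0) =
          (if v \<in> closed_nbhd G u then real (w u) else 0)" by simp
    qed
    also have "\<dots> = (\<Sum>u\<in>I. real (w u) * real (card (H \<inter> closed_nbhd G u)))"
      by (intro sum.cong refl) (simp add: sum.inter_restrict[symmetric] finH mult.commute)
    also have "\<dots> < (\<Sum>u\<in>I. real (w u) * (\<beta> * real (card H)))"
    proof (rule sum_strict_mono_ex1[OF finI])
      show "\<forall>u\<in>I. real (w u) * real (card (H \<inter> closed_nbhd G u)) \<le> real (w u) * (\<beta> * real (card H))"
        using light by (intro ballI mult_left_mono less_imp_le[OF light]) auto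
      show "\<exists>u\<in>I. real (w u) * real (card (H \<inter> closed_nbhd G u)) < real (w u) * (\<beta> * real (card H))"
        using light u0 by (intro bexI[of _ u0] mult_strict_left_mono) auto
    qed
    also have "\<dots> = \<beta> * real (sum w I) * real (card H)"
      by (simp add: sum_distrib_right[symmetric])
    finally show False by simp
  qed
  then show ?thesis using that by blast
qed

text \<open>Greedy covering. Heaviness is measured against all of \<open>I\<close>, so it persists
  for the vertices not yet dominated, and each further choice shrinks their number by the factor
  \<open>1 - \<beta>\<close>.\<close>

lemma heavy_vertices_cover:
  fixes w :: "'a \<Rightarrow> nat" and \<beta> :: real
  assumes fin: "finite (verts G)" and I: "I \<subseteq> verts G" "sum w I > 0" and H: "H \<subseteq> verts G"
    and heavy: "\<And>v. v \<in> H \<Longrightarrow> \<beta> * real (sum w I) \<le> real (sum w (I \<inter> closed_nbhd G v))"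
    and \<beta>: "\<beta> \<le> 1"
  shows "\<exists>J\<subseteq>I. card J \<le> k \<and> real (card (H - J - open_nbhd G J)) \<le> (1 - \<beta>) ^ k * real (card H)"
proof (induction k)
  case 0
  then show ?case by (intro exI[of _ "{}"]) (simp add: open_nbhd_def)
next
  case (Suc k)
  then obtain J where J: "J \<subseteq> I" "card J \<le> k"
    "real (card (H - J - open_nbhd G J)) \<le> (1 - \<beta>) ^ k * real (card H)" by blast
  define H' where "H' = H - J - open_nbhd G J"
  have H': "H' \<subseteq> verts G" "finite H'" using H fin finite_subset[of H "verts G"] by (auto simp: H'_def)
  obtain u where u: "u \<in> I" "\<beta> * real (card H') \<le> real (card (H' \<inter> closed_nbhd G u))"
    by (rule vertex_covering_fraction[OF fin I H'(1), of \<beta>]) (use heavy H'_def in blast)+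
  have sub: "H - insert u J - open_nbhd G (insert u J) = H' - H' \<inter> closed_nbhd G u"
    using H' by (auto simp: H'_def open_nbhd_def closed_nbhd_def adj_sym)
  have "real (card (H' - H' \<inter> closed_nbhd G u)) = real (card H') - real (card (H' \<inter> closed_nbhd G u))"
    using H' by (subst card_Diff_subset) (auto simp: card_mono of_nat_diff)
  also have "\<dots> \<le> (1 - \<beta>) * real (card H')" using u by (simp add: algebra_simps)
  also have "\<dots> \<le> (1 - \<beta>) * ((1 - \<beta>) ^ k * real (card H))"
    using J(3) \<beta> by (intro mult_left_mono) (auto simp: H'_def)
  finally have "real (card (H - insert u J - open_nbhd G (insert u J))) \<le> (1 - \<beta>) ^ Suc k * real (card H)"
    by (simp add: sub mult.assoc)
  moreover have "card (insert u J) \<le> Suc k" using J by (metis card_insert_le_m1 diff_Suc_1 zero_less_Suc)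
  ultimately show ?case using J u by (intro exI[of _ "insert u J"]) auto
qed

section \<open>Good sets and balanced separators as neighbourhoods of few vertices\<close>

lemma sum_UN_le:
  fixes w :: "'a \<Rightarrow> nat"
  assumes "finite A" "\<And>i. i \<in> A \<Longrightarrow> finite (B i)"
  shows "sum w (\<Union>i\<in>A. B i) \<le> (\<Sum>i\<in>A. sum w (B i))"
  using assms
proof (induction A rule: finite_induct)
  case (insert a A)
  have "sum w (B a \<union> (\<Union>i\<in>A. B i)) \<le> sum w (B a) + sum w (\<Union>i\<in>A. B i)"
    using sum.union_inter[of "B a" "\<Union>i\<in>A. B i" w] insert by simp
  also have "\<dots> \<le> sum w (B a) + (\<Sum>i\<in>A. sum w (B i))" using insert by simp
  finally show ?case using insert by simp
qed simp

lemma sum_restrict_weight: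
  "finite A \<Longrightarrow> sum (restrict_weight w I) A = sum w (A \<inter> I)"
  by (simp add: restrict_weight_def sum.inter_restrict)

text \<open>The deleted set is the open neighbourhood of \<open>J \<union> Q\<close>, where
  \<open>J \<subseteq> I\<close> dominates the heavy vertices and \<open>Q\<close> separates the
  rest. The neighbours of \<open>J\<close> avoid \<open>I\<close>, and each of the at most
  \<open>T\<close> vertices of \<open>Q\<close> is light, so with the threshold
  \<open>\<gamma> / (2 * T)\<close> the deleted weight is at most \<gamma>/2 of the total. The
  factor 2 is spent on the last condition of \<open>good_set\<close>: the complement of a component
  is only known to carry half of the weight.\<close>

lemma good_open_nbhd_exists:
  fixes w :: "nat \<Rightarrow> nat"
  assumes G: "simple_graph G" and T: "T \<ge> 1"
    and free: "\<And>l. l \<ge> T \<Longrightarrow> \<not> has_induced G (cycle_graph l)"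
    and I: "independent G I" "sum w I > 0" and \<gamma>: "0 < \<gamma>" "\<gamma> < 1 / 2"
    and k: "(1 - \<gamma> / (2 * real T)) ^ k * real (card (verts G)) < 1"
  obtains S where "S \<subseteq> verts G" "card S \<le> k + T"
    "good_set G (restrict_weight w I) \<gamma> (1 / 4) (open_nbhd G S)"
proof -
  let ?V = "verts G" and ?w = "restrict_weight w I"
  define \<beta> where "\<beta> = \<gamma> / (2 * real T)"
  have \<beta>: "0 < \<beta>" "\<beta> \<le> 1"
  proof -
    show "0 < \<beta>" using \<gamma> T by (simp add: \<beta>_def)
    have "\<gamma> \<le> 2 * real T" using \<gamma> T by linarith
    then show "\<beta> \<le> 1" using T by (simp add: \<beta>_def)
  qed
  have fin: "finite ?V" using G by (simp add: simple_graph_def)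
  have IV: "I \<subseteq> ?V" using I by (simp add: independent_def)
  have wI: "sum ?w ?V = sum w I"
    using sum_restrict_weight[OF fin] IV by (metis inf.absorb2)
  define H where "H = {v \<in> ?V. \<beta> * real (sum w I) \<le> real (sum w (I \<inter> closed_nbhd G v))}"
  obtain J where J: "J \<subseteq> I" "card J \<le> k"
    "real (card (H - J - open_nbhd G J)) \<le> (1 - \<beta>) ^ k * real (card H)"
    using heavy_vertices_cover[OF fin IV I(2), of H \<beta> k] \<beta> by (auto simp: H_def)
  have "(1 - \<beta>) ^ k * real (card H) \<le> (1 - \<beta>) ^ k * real (card ?V)"
    using \<beta> fin by (intro mult_left_mono) (auto simp: H_def intro!: card_mono)
  then have "real (card (H - J - open_nbhd G J)) < 1" using J k by (simp add: \<beta>_def)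
  moreover have "finite H" using fin by (simp add: H_def)
  \<comment> \<open>A cardinality below 1 is 0: every heavy vertex is dominated by
    \<open>J\<close>.\<close>
  ultimately have HJ: "H \<subseteq> J \<union> open_nbhd G J" by auto
  define W where "W = ?V - J - open_nbhd G J"
  have WV: "W \<subseteq> ?V" by (auto simp: W_def)
  obtain Q where Q: "Q \<subseteq> W" "card Q \<le> T"
    "\<And>C. C \<subseteq> W - Q - open_nbhd G Q \<Longrightarrow> connected_within G C \<Longrightarrow> 2 * sum ?w C \<le> sum ?w W"
    using separator[OF G WV free T] by blast
  define S where "S = J \<union> Q"
  define X where "X = open_nbhd G S"
  have finX: "finite X" unfolding X_def using open_nbhd_subset[OF G] fin by (rule finite_subset)
  have finQ: "finite Q" using Q(1) WV fin by (meson finite_subset)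
  have XV: "X \<subseteq> ?V" using open_nbhd_subset[OF G] by (simp add: X_def)
  have IJ: "I \<inter> open_nbhd G J = {}"
    using I J by (auto simp: independent_def open_nbhd_def)
  have wX: "2 * real (sum ?w X) \<le> \<gamma> * real (sum w I)"
  proof -
    have "X \<inter> I \<subseteq> (\<Union>q\<in>Q. I \<inter> closed_nbhd G q)"
      using IJ IV by (auto simp: X_def S_def open_nbhd_def closed_nbhd_def adj_sym)
    then have "sum w (X \<inter> I) \<le> sum w (\<Union>q\<in>Q. I \<inter> closed_nbhd G q)"
      using finQ IV fin by (intro sum_mono2) (auto intro: finite_subset)
    also have "\<dots> \<le> (\<Sum>q\<in>Q. sum w (I \<inter> closed_nbhd G q))"
      using finQ IV fin by (intro sum_UN_le) (auto intro: finite_subset)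
    finally have "real (sum ?w X) \<le> real (\<Sum>q\<in>Q. sum w (I \<inter> closed_nbhd G q))"
      using sum_restrict_weight[OF finX] by (metis of_nat_le_iff)
    also have "\<dots> = (\<Sum>q\<in>Q. real (sum w (I \<inter> closed_nbhd G q)))" by simp
    also have "\<dots> \<le> (\<Sum>q\<in>Q. \<beta> * real (sum w I))"
    proof (rule sum_mono)
      fix q assume q: "q \<in> Q"
      have "q \<notin> H" using q Q HJ by (auto simp: W_def)
      then show "real (sum w (I \<inter> closed_nbhd G q)) \<le> \<beta> * real (sum w I)"
        using q Q WV by (auto simp: H_def)
    qed
    also have "\<dots> = real (card Q) * (\<beta> * real (sum w I))" by simp
    also have "\<dots> \<le> real T * (\<beta> * real (sum w I))"
      using Q \<beta> by (intro mult_right_mono) (auto simp del: of_nat_sum)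
    also have "\<dots> = \<gamma> * real (sum w I) / 2" using T by (simp add: \<beta>_def)
    finally show ?thesis by simp
  qed
  have arith: "a \<le> (1 - 1 / 4) * b" if "2 * a \<le> b" "0 \<le> b" for a b :: real
    using that by simp
  have "good_set G ?w \<gamma> (1 / 4) X"
    unfolding good_set_def wI
  proof (intro conjI ballI impI)
    show "X \<subseteq> ?V" by (rule XV)
    show "real (sum ?w X) \<le> \<gamma> * real (sum w I)" using wX by linarith
    fix C assume C: "C \<in> components (delete_verts G X)" "\<not> is_singleton C"
    note comp = components_delete_verts[OF C(1)]
    \<comment> \<open>A vertex of \<open>S\<close> that survives the deletion has lost all its
      neighbours, so a component with more than one vertex contains none of them and the separator
      applies to it.\<close>
    have "C \<inter> S = {}"
      using connected_within_outside_open_nbhd[OF comp(3) _ comp(2) C(2), of S] comp(1)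
      by (auto simp: X_def)
    then have "C \<subseteq> W - Q - open_nbhd G Q"
      using comp(1) by (auto simp: W_def X_def S_def open_nbhd_Un)
    then have "2 * sum ?w C \<le> sum ?w W" by (rule Q(3)[OF _ comp(3)])
    also have "\<dots> \<le> sum ?w ?V" using fin WV by (intro sum_mono2) auto
    finally have half: "2 * sum ?w C \<le> sum w I" by (simp only: wI)
    then have "2 * real (sum ?w C) \<le> real (sum w I)"
      by (metis of_nat_le_iff of_nat_mult of_nat_numeral)
    then show "real (sum ?w C) \<le> (1 - 1 / 4) * real (sum w I)"
      by (rule arith) (rule of_nat_0_le_iff)
    have "sum ?w (?V - C) + sum ?w C = sum w I"
      using comp(1) fin wI by (metis Diff_subset dual_order.trans sum.subset_diff)
    then have "sum w I \<le> 2 * sum ?w (?V - C)" using half by linarith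
    then have "real (sum w I) \<le> 2 * real (sum ?w (?V - C))"
      by (metis of_nat_le_iff of_nat_mult of_nat_numeral)
    then have "\<gamma> * real (sum w I) \<le> \<gamma> * (2 * real (sum ?w (?V - C)))"
      using \<gamma> by (intro mult_left_mono) auto
    then show "real (sum ?w X) \<le> \<gamma> * real (sum ?w (?V - C))" using wX by linarith
  qed
  moreover have "card S \<le> k + T"
    using J(2) Q(2) card_Un_le[of J Q] by (simp add: S_def)
  moreover have "S \<subseteq> ?V" using J IV Q WV by (auto simp: S_def)
  ultimately show ?thesis using that by (simp add: X_def)
qed

text \<open>The separator says nothing about components that meet \<open>S\<close>. After the
  deletion of the open neighbourhood these are single vertices, which are small enough as soon as
  the graph has two vertices.\<close>

lemma balanced_open_nbhd_exists:
  assumes G: "simple_graph G" and T: "T \<ge> 1" and two: "2 \<le> card (verts G)"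
    and free: "\<And>l. l \<ge> T \<Longrightarrow> \<not> has_induced G (cycle_graph l)"
  obtains S where "S \<subseteq> verts G" "card S \<le> T"
    "\<And>C. C \<subseteq> verts G - open_nbhd G S \<Longrightarrow> connected_within G C \<Longrightarrow> 2 * card C \<le> card (verts G)"
proof -
  from separator[OF G subset_refl free T, where w = "\<lambda>_. 1"]
  obtain S where S: "S \<subseteq> verts G" "card S \<le> T"
    and sep: "\<And>C. C \<subseteq> verts G - S - open_nbhd G S \<Longrightarrow> connected_within G C \<Longrightarrow>
      2 * card C \<le> card (verts G)"
    unfolding card_eq_sum by metis
  have "2 * card C \<le> card (verts G)"
    if C: "C \<subseteq> verts G - open_nbhd G S" "connected_within G C" for C
  proof (cases "C = {} \<or> is_singleton C")
    case True
    then show ?thesis using two by (auto simp: is_singleton_def)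
  next
    case False
    then have "C \<inter> S = {}"
      using connected_within_outside_open_nbhd[OF C(2)] C by blast
    then have "C \<subseteq> verts G - S - open_nbhd G S" using C(1) by blast
    then show ?thesis using C(2) by (rule sep)
  qed
  then show ?thesis using S by (rule that[rotated 2])
qed

lemma card_open_nbhd_le:
  assumes "simple_graph G" "S \<subseteq> verts G" "card S \<le> T" "0 \<le> b"
    "\<forall>v\<in>verts G. real (card (closed_nbhd G v)) \<le> b"
  shows "real (card (open_nbhd G S)) \<le> real T * b"
proof -
  have fin: "finite (verts G)" "finite S"
    using assms finite_subset by (auto simp: simple_graph_def)
  have "open_nbhd G S \<subseteq> (\<Union>v\<in>S. closed_nbhd G v)"
    using assms(1) by (auto simp: open_nbhd_def closed_nbhd_def adj_sym dest: adj_verts)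
  then have "card (open_nbhd G S) \<le> card (\<Union>v\<in>S. closed_nbhd G v)"
    using fin by (intro card_mono) (auto simp: closed_nbhd_def)
  also have "\<dots> \<le> (\<Sum>v\<in>S. card (closed_nbhd G v))" using fin by (intro card_UN_le)
  finally have "real (card (open_nbhd G S)) \<le> (\<Sum>v\<in>S. real (card (closed_nbhd G v)))"
    by (metis of_nat_le_iff of_nat_sum)
  also have "\<dots> \<le> (\<Sum>v\<in>S. b)" using assms by (intro sum_mono) auto
  also have "\<dots> \<le> real T * b" using assms by (simp add: mult_right_mono)
  finally show ?thesis .
qed

subsection \<open>The graph class\<close>

lemma isomorphic_trans:
  assumes "isomorphic A B" "isomorphic B C" shows "isomorphic A C"
proof -
  obtain f where f: "bij_betw f (verts A) (verts B)"
    "\<forall>u\<in>verts A. \<forall>v\<in>verts A. adj A u v \<longleftrightarrow> adj B (f u) (f v)"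
    using assms(1) by (auto simp: isomorphic_def)
  obtain g where g: "bij_betw g (verts B) (verts C)"
    "\<forall>u\<in>verts B. \<forall>v\<in>verts B. adj B u v \<longleftrightarrow> adj C (g u) (g v)"
    using assms(2) by (auto simp: isomorphic_def)
  have "f u \<in> verts B" if "u \<in> verts A" for u using f(1) that by (auto simp: bij_betw_def)
  then show ?thesis
    using f g unfolding isomorphic_def by (intro exI[of _ "g \<circ> f"]) (auto intro: bij_betw_trans)
qed

lemma has_induced_induced:
  assumes "has_induced (induced G S) H" shows "has_induced G H"
proof -
  obtain R where R: "R \<subseteq> verts G \<inter> S" "isomorphic (induced (induced G S) R) H"
    using assms by (auto simp: has_induced_def verts_induced)
  moreover have "induced (induced G S) R = induced G R"
    using R(1) by (auto simp: induced_def)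
  ultimately show ?thesis by (auto simp: has_induced_def)
qed

lemma has_induced_isomorphic:
  assumes "isomorphic G G'" "has_induced G' H" shows "has_induced G H"
proof -
  obtain f where f: "bij_betw f (verts G) (verts G')"
    "\<forall>u\<in>verts G. \<forall>v\<in>verts G. adj G u v \<longleftrightarrow> adj G' (f u) (f v)"
    using assms(1) by (auto simp: isomorphic_def)
  obtain R where R: "R \<subseteq> verts G'" "isomorphic (induced G' R) H"
    using assms(2) by (auto simp: has_induced_def)
  define S where "S = {v \<in> verts G. f v \<in> R}"
  have "f ` S = R" using f(1) R(1) by (auto simp: S_def bij_betw_def)
  then have "bij_betw f S R"
    using f(1) by (auto simp: S_def bij_betw_def intro: inj_on_subset)
  then have "isomorphic (induced G S) (induced G' R)"
    using f(2) R(1) unfolding isomorphic_def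
    by (intro exI[of _ f]) (auto simp: verts_induced adj_induced S_def Int_absorb1 Int_absorb2)
  then have "isomorphic (induced G S) H" using R(2) by (rule isomorphic_trans)
  moreover have "S \<subseteq> verts G" by (auto simp: S_def)
  ultimately show ?thesis unfolding has_induced_def by blast
qed

lemma hereditary_long_cycle_free: "hereditary (long_cycle_free t)"
  unfolding hereditary_def long_cycle_free_def
  using has_induced_induced has_induced_isomorphic simple_graph_induced by blast

subsection \<open>Total correctness with time bounds\<close>

primrec written_regs :: "com \<Rightarrow> string set" where
  "written_regs Skip = {}"
| "written_regs (Assign x a) = {x}"
| "written_regs (Store A i j a) = {}"
| "written_regs (Seq c d) = written_regs c \<union> written_regs d"
| "written_regs (Cond b c d) = written_regs c \<union> written_regs d"
| "written_regs (While b c) = written_regs c"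

primrec written_arrays :: "com \<Rightarrow> string set" where
  "written_arrays Skip = {}"
| "written_arrays (Assign x a) = {}"
| "written_arrays (Store A i j a) = {A}"
| "written_arrays (Seq c d) = written_arrays c \<union> written_arrays d"
| "written_arrays (Cond b c d) = written_arrays c \<union> written_arrays d"
| "written_arrays (While b c) = written_arrays c"

text \<open>The rules below hand the frame of the part already executed to the next obligation, so
  that invariants mention only the registers and arrays that change.\<close>

definition frame :: "com \<Rightarrow> state \<Rightarrow> state \<Rightarrow> bool" where
  "frame c s s' \<longleftrightarrow> (\<forall>x. x \<notin> written_regs c \<longrightarrow> regs s' x = regs s x) \<and>
     (\<forall>A. A \<notin> written_arrays c \<longrightarrow> cells s' A = cells s A)"

lemma exec_frame: "exec c s T s' \<Longrightarrow> frame c s s'"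
  by (induction rule: exec.induct) (auto simp: frame_def store_def)

lemma frame_regs: "frame c s s' \<Longrightarrow> x \<notin> written_regs c \<Longrightarrow> regs s' x = regs s x"
  by (simp add: frame_def)

lemma frame_cells: "frame c s s' \<Longrightarrow> A \<notin> written_arrays c \<Longrightarrow> cells s' A = cells s A"
  by (simp add: frame_def)

text \<open>Time enters as an upper bound, so that branches and loop rounds of different cost can
  share one number.\<close>

definition runs :: "com \<Rightarrow> state \<Rightarrow> nat \<Rightarrow> (state \<Rightarrow> bool) \<Rightarrow> bool" where
  "runs c s B Q \<longleftrightarrow> (\<exists>T s'. exec c s T s' \<and> T \<le> B \<and> Q s')"

lemma runs_mono:
  assumes "runs c s B P" "B \<le> B'" "\<And>s'. P s' \<Longrightarrow> frame c s s' \<Longrightarrow> Q s'"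
  shows "runs c s B' Q"
  using assms exec_frame unfolding runs_def by (meson le_trans)

lemma runs_Skip: "Q s \<Longrightarrow> 1 \<le> B \<Longrightarrow> runs Skip s B Q"
  unfolding runs_def using exec_Skip by blast

lemma runs_Assign:
  "Q (s\<lparr>regs := (regs s)(x := aval s a)\<rparr>) \<Longrightarrow> 1 + acost a \<le> B \<Longrightarrow> runs (Assign x a) s B Q"
  unfolding runs_def using exec_Assign by blast

lemma runs_Store:
  "Q (store A (aval s i) (aval s j) (aval s a) s) \<Longrightarrow> 1 + acost i + acost j + acost a \<le> B \<Longrightarrow>
    runs (Store A i j a) s B Q"
  unfolding runs_def using exec_Store by blast

lemma runs_Seq:
  assumes "runs c s B1 P" "\<And>s'. P s' \<Longrightarrow> frame c s s' \<Longrightarrow> runs d s' B2 Q" "B1 + B2 \<le> B"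
  shows "runs (Seq c d) s B Q"
proof -
  obtain T s' where 1: "exec c s T s'" "T \<le> B1" "P s'" using assms(1) by (auto simp: runs_def)
  obtain T' s'' where "exec d s' T' s''" "T' \<le> B2" "Q s''"
    using assms(2)[OF 1(3) exec_frame[OF 1(1)]] by (auto simp: runs_def)
  with 1 assms(3) show ?thesis
    unfolding runs_def by (intro exI[of _ "T + T'"] exI[of _ s'']) (auto intro: exec_Seq)
qed

lemma runs_Cond:
  assumes "bval s b \<Longrightarrow> runs c s B1 Q" "\<not> bval s b \<Longrightarrow> runs d s B1 Q" "1 + bcost b + B1 \<le> B"
  shows "runs (Cond b c d) s B Q"
proof (cases "bval s b")
  case True
  then obtain T s' where "exec c s T s'" "T \<le> B1" "Q s'" using assms(1) by (auto simp: runs_def)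
  moreover from exec_Cond_True[OF True this(1)] have "exec (Cond b c d) s (1 + bcost b + T) s'" .
  ultimately show ?thesis
    using assms(3) unfolding runs_def by (meson add_le_cancel_left le_trans)
next
  case False
  then obtain T s' where "exec d s T s'" "T \<le> B1" "Q s'" using assms(2) by (auto simp: runs_def)
  moreover from exec_Cond_False[OF False this(1)] have "exec (Cond b c d) s (1 + bcost b + T) s'" .
  ultimately show ?thesis
    using assms(3) unfolding runs_def by (meson add_le_cancel_left le_trans)
qed

lemma runs_While_False:
  "\<not> bval s b \<Longrightarrow> Q s \<Longrightarrow> 1 + bcost b \<le> B \<Longrightarrow> runs (While b c) s B Q"
  unfolding runs_def using exec_While_False by blast

lemma runs_While_True:
  assumes "bval s b" "runs c s B1 P" "\<And>s'. P s' \<Longrightarrow> frame c s s' \<Longrightarrow> runs (While b c) s' B2 Q"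
    "1 + bcost b + B1 + B2 \<le> B"
  shows "runs (While b c) s B Q"
proof -
  obtain T s' where 1: "exec c s T s'" "T \<le> B1" "P s'" using assms(2) by (auto simp: runs_def)
  obtain T' s'' where 2: "exec (While b c) s' T' s''" "T' \<le> B2" "Q s''"
    using assms(3)[OF 1(3) exec_frame[OF 1(1)]] by (auto simp: runs_def)
  have "exec (While b c) s (1 + bcost b + T + T') s''"
    using assms(1) 1(1) 2(1) by (rule exec_While_True)
  moreover have "1 + bcost b + T + T' \<le> B" using 1 2 assms(4) by linarith
  ultimately show ?thesis using 2 unfolding runs_def by blast
qed

definition For :: "string \<Rightarrow> string \<Rightarrow> com \<Rightarrow> com" where
  "For x y c = Seq (Assign x (Const 0))
     (While (Less (Var x) (Var y)) (Seq c (Assign x (Add (Var x) (Const 1)))))"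

lemma written_regs_For [simp]: "written_regs (For x y c) = insert x (written_regs c)"
  by (auto simp: For_def)

lemma written_arrays_For [simp]: "written_arrays (For x y c) = written_arrays c"
  by (auto simp: For_def)

text \<open>A round costs 8 more than its body: 4 for the test and 4 for the increment. The final 6
  pays for the initialisation (2) and the failing test (4). \<open>Inv (Suc i)\<close> is demanded
  of the state with the counter already advanced, because \<open>For\<close> appends the increment
  to the body.\<close>

lemma runs_For:
  assumes xy: "x \<noteq> y" "x \<notin> written_regs c" "y \<notin> written_regs c"
    and init: "Inv 0 (s\<lparr>regs := (regs s)(x := 0)\<rparr>)"
    and step: "\<And>i s'. \<lbrakk>i < regs s y; regs s' x = i; frame (For x y c) s s'; Inv i s'\<rbrakk> \<Longrightarrow>
      runs c s' B (\<lambda>s''. Inv (Suc i) (s''\<lparr>regs := (regs s'')(x := Suc i)\<rparr>))"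
    and final: "\<And>s'. \<lbrakk>Inv (regs s y) s'; frame (For x y c) s s'\<rbrakk> \<Longrightarrow> Q s'"
    and B': "regs s y * (B + 8) + 6 \<le> B'"
  shows "runs (For x y c) s B' Q"
proof -
  let ?N = "regs s y"
  let ?W = "While (Less (Var x) (Var y)) (Seq c (Assign x (Add (Var x) (Const 1))))"
  have loop: "runs ?W s' ((?N - i) * (B + 8) + 4) Q"
    if "i \<le> ?N" "regs s' x = i" "frame (For x y c) s s'" "Inv i s'" for i s'
    using that
  proof (induction "?N - i" arbitrary: i s')
    case 0
    have "regs s' y = ?N" using frame_regs[OF 0(4), of y] xy by simp
    then show ?case
      using 0 final by (intro runs_While_False) auto
  next
    case (Suc k)
    then have lt: "i < ?N" by simp
    have y: "regs s' y = ?N" using frame_regs[OF Suc.prems(3), of y] xy by simp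
    have k: "?N - i = Suc (?N - Suc i)" using lt by simp
    show ?case
    proof (rule runs_While_True)
      show "bval s' (Less (Var x) (Var y))" using y lt Suc by simp
      let ?P = "\<lambda>t. regs t x = Suc i \<and> Inv (Suc i) t"
      show "runs (Seq c (Assign x (Add (Var x) (Const 1)))) s' (B + 4) ?P"
      proof (rule runs_Seq)
        show "runs c s' B (\<lambda>s''. Inv (Suc i) (s''\<lparr>regs := (regs s'')(x := Suc i)\<rparr>))"
          using step lt Suc by blast
        show "runs (Assign x (Add (Var x) (Const 1))) t 4 ?P"
          if "Inv (Suc i) (t\<lparr>regs := (regs t)(x := Suc i)\<rparr>)" "frame c s' t" for t
          using that frame_regs[OF that(2) xy(2)] Suc by (intro runs_Assign) auto
      qed simp
      show "runs ?W t ((?N - Suc i) * (B + 8) + 4) Q"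
        if t: "?P t" "frame (Seq c (Assign x (Add (Var x) (Const 1)))) s' t" for t
      proof (rule Suc.hyps(1))
        show "frame (For x y c) s t" using Suc.prems(3) t(2) by (auto simp: frame_def)
      qed (use t lt Suc.hyps(2) in auto)
    qed (simp add: k)
  qed
  show ?thesis
    unfolding For_def
  proof (rule runs_Seq)
    let ?s = "s\<lparr>regs := (regs s)(x := 0)\<rparr>"
    show "runs (Assign x (Const 0)) s 2 (\<lambda>t. t = ?s)" by (intro runs_Assign) auto
    show "runs ?W t (?N * (B + 8) + 4) Q" if "t = ?s" for t
      using loop[of 0 t] that init by (simp add: frame_def)
    show "2 + (?N * (B + 8) + 4) \<le> B'" using B' by simp
  qed
qed

subsection \<open>Enumerating neighbourhoods of small sets\<close>

text \<open>Appends the union of row \<open>p\<close> and the neighbourhood of \<open>v\<close>.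
  Addition of entries serves as union, because only their being nonzero matters in
  \<open>out_family\<close>.\<close>

definition add_row :: com where
  "add_row = Seq (For ''u'' ''n'' (Store ''D'' (Var ''m'') (Var ''u'')
       (Add (Cell ''D'' (Var ''p'') (Var ''u'')) (Cell ''E'' (Var ''v'') (Var ''u'')))))
     (Assign ''m'' (Add (Var ''m'') (Const 1)))"

definition add_rows :: com where
  "add_rows = For ''v'' ''n'' add_row"

text \<open>The row count is frozen in \<open>e\<close>, since \<open>m\<close> grows while the old
  rows are processed. Old rows are kept, so a stage multiplies their number by
  \<open>n + 1\<close>.\<close>

definition stage :: com where
  "stage = Seq (Assign ''e'' (Var ''m'')) (For ''p'' ''e'' add_rows)"

primrec stages :: "nat \<Rightarrow> com" where
  "stages 0 = Skip"
| "stages (Suc k) = Seq stage (stages k)"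

lemma written_add_row [simp]:
  "written_regs add_row = {''u'', ''m''}" "written_arrays add_row = {''D''}"
  by (auto simp: add_row_def)

lemma written_add_rows [simp]:
  "written_regs add_rows = {''u'', ''m'', ''v''}" "written_arrays add_rows = {''D''}"
  by (auto simp: add_rows_def)

lemma written_stage [simp]:
  "written_regs stage = {''u'', ''m'', ''v'', ''e'', ''p''}" "written_arrays stage = {''D''}"
  by (auto simp: stage_def)

lemma written_stages:
  "written_regs (stages k) \<subseteq> {''u'', ''m'', ''v'', ''e'', ''p''}" "written_arrays (stages k) \<subseteq> {''D''}"
  by (induction k) auto

text \<open>\<open>p < m\<close> keeps the row that is read apart from row \<open>m\<close>, which
  is written.\<close>

lemma runs_add_row:
  assumes "regs s ''p'' < regs s ''m''"
  shows "runs add_row s (18 * regs s ''n'' + 10) (\<lambda>s'. regs s' ''m'' = Suc (regs s ''m'') \<and>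
    (\<forall>j<regs s ''m''. cells s' ''D'' j = cells s ''D'' j) \<and>
    (\<forall>u<regs s ''n''. cells s' ''D'' (regs s ''m'') u =
       cells s ''D'' (regs s ''p'') u + cells s ''E'' (regs s ''v'') u))"
  unfolding add_row_def
proof (rule runs_Seq)
  let ?I = "\<lambda>i s'. (\<forall>j<regs s ''m''. cells s' ''D'' j = cells s ''D'' j) \<and>
    (\<forall>u<i. cells s' ''D'' (regs s ''m'') u =
       cells s ''D'' (regs s ''p'') u + cells s ''E'' (regs s ''v'') u)"
  let ?c = "Store ''D'' (Var ''m'') (Var ''u'')
       (Add (Cell ''D'' (Var ''p'') (Var ''u'')) (Cell ''E'' (Var ''v'') (Var ''u'')))"
  show "runs (For ''u'' ''n'' ?c) s (18 * regs s ''n'' + 6) (?I (regs s ''n''))"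
  proof (rule runs_For[where Inv = ?I and B = 10])
    fix i s' assume s': "regs s' ''u'' = i" "frame (For ''u'' ''n'' ?c) s s'" "?I i s'"
    have "regs s' ''m'' = regs s ''m''" "regs s' ''p'' = regs s ''p''" "regs s' ''v'' = regs s ''v''"
      "cells s' ''E'' = cells s ''E''"
      using s'(2) by (auto simp: frame_def)
    then show "runs ?c s' 10 (\<lambda>s''. ?I (Suc i) (s''\<lparr>regs := (regs s'')(''u'' := Suc i)\<rparr>))"
      using s' assms by (intro runs_Store) (auto simp: store_def less_Suc_eq)
  qed auto
  show "runs (Assign ''m'' (Add (Var ''m'') (Const 1))) s' 4 (\<lambda>s'. regs s' ''m'' = Suc (regs s ''m'') \<and>
    ?I (regs s ''n'') s')"
    if "?I (regs s ''n'') s'" "frame (For ''u'' ''n'' ?c) s s'" for s'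
  proof -
    have "regs s' ''m'' = regs s ''m''" using that(2) by (auto simp: frame_def)
    then show ?thesis using that(1) by (intro runs_Assign) auto
  qed
qed simp

lemma runs_add_rows:
  assumes "regs s ''p'' < regs s ''m''" "n = regs s ''n''"
  shows "runs add_rows s (n * (18 * n + 18) + 6) (\<lambda>s'. regs s' ''m'' = regs s ''m'' + n \<and>
    (\<forall>j<regs s ''m''. cells s' ''D'' j = cells s ''D'' j) \<and>
    (\<forall>v<n. \<forall>u<n. cells s' ''D'' (regs s ''m'' + v) u =
       cells s ''D'' (regs s ''p'') u + cells s ''E'' v u))"
  unfolding add_rows_def
proof (rule runs_For[where B = "18 * n + 10" and Inv = "\<lambda>i s'. regs s' ''m'' = regs s ''m'' + i \<and>
    (\<forall>j<regs s ''m''. cells s' ''D'' j = cells s ''D'' j) \<and>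
    (\<forall>v<i. \<forall>u<n. cells s' ''D'' (regs s ''m'' + v) u =
       cells s ''D'' (regs s ''p'') u + cells s ''E'' v u)"])
  fix i s'
  assume s': "regs s' ''v'' = i" "frame (For ''v'' ''n'' add_row) s s'"
    "regs s' ''m'' = regs s ''m'' + i \<and> (\<forall>j<regs s ''m''. cells s' ''D'' j = cells s ''D'' j) \<and>
    (\<forall>v<i. \<forall>u<n. cells s' ''D'' (regs s ''m'' + v) u =
       cells s ''D'' (regs s ''p'') u + cells s ''E'' v u)"
  have eq: "regs s' ''p'' = regs s ''p''" "regs s' ''n'' = n" "cells s' ''E'' = cells s ''E''"
    using s'(2) assms by (auto simp: frame_def)
  have "regs s' ''p'' < regs s' ''m''" using eq s' assms by simp
  from runs_add_row[OF this]
  show "runs add_row s' (18 * n + 10) (\<lambda>s''. regs (s''\<lparr>regs := (regs s'')(''v'' := Suc i)\<rparr>) ''m'' =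
      regs s ''m'' + Suc i \<and>
    (\<forall>j<regs s ''m''. cells (s''\<lparr>regs := (regs s'')(''v'' := Suc i)\<rparr>) ''D'' j = cells s ''D'' j) \<and>
    (\<forall>v<Suc i. \<forall>u<n. cells (s''\<lparr>regs := (regs s'')(''v'' := Suc i)\<rparr>) ''D'' (regs s ''m'' + v) u =
       cells s ''D'' (regs s ''p'') u + cells s ''E'' v u))"
    by (rule runs_mono) (use s' eq assms in \<open>auto simp: less_Suc_eq\<close>)
qed (use assms in auto)

lemma runs_stage:
  assumes "M = regs s ''m''" "n = regs s ''n''"
  shows "runs stage s (M * (n * (18 * n + 18) + 14) + 8) (\<lambda>s'. regs s' ''m'' = M + M * n \<and>
    (\<forall>j<M. cells s' ''D'' j = cells s ''D'' j) \<and>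
    (\<forall>p<M. \<forall>v<n. \<forall>u<n. cells s' ''D'' (M + p * n + v) u =
       cells s ''D'' p u + cells s ''E'' v u))"
  unfolding stage_def
proof (rule runs_Seq)
  let ?s = "s\<lparr>regs := (regs s)(''e'' := M)\<rparr>"
  let ?I = "\<lambda>i s'. regs s' ''m'' = M + i * n \<and> (\<forall>j<M. cells s' ''D'' j = cells s ''D'' j) \<and>
    (\<forall>p<i. \<forall>v<n. \<forall>u<n. cells s' ''D'' (M + p * n + v) u =
       cells s ''D'' p u + cells s ''E'' v u)"
  show "runs (Assign ''e'' (Var ''m'')) s 2 (\<lambda>t. t = ?s)"
    using assms by (intro runs_Assign) auto
  show "runs (For ''p'' ''e'' add_rows) t (M * (n * (18 * n + 18) + 14) + 6) (?I M)"
    if t: "t = ?s" for t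
  proof (rule runs_For[where Inv = ?I and B = "n * (18 * n + 18) + 6"])
    fix i s'
    assume s': "i < regs t ''e''" "regs s' ''p'' = i" "frame (For ''p'' ''e'' add_rows) t s'" "?I i s'"
    have eq: "regs s' ''n'' = n" "cells s' ''E'' = cells s ''E''"
      using s'(3) assms t by (auto simp: frame_def)
    have iM: "i < M" using s' t by simp
    then have lt: "regs s' ''p'' < regs s' ''m''" using s' by simp
    \<comment> \<open>The blocks of earlier \<open>p\<close> end below row \<open>M + i * n\<close>,
      where the current block begins.\<close>
    have old: "cells s'' ''D'' (M + p * n + v) = cells s' ''D'' (M + p * n + v)"
      if "\<forall>j<M + i * n. cells s'' ''D'' j = cells s' ''D'' j" "p < i" "v < n" for p v s''
    proof -
      have "p * n + v < Suc p * n" using that by simp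
      also have "\<dots> \<le> i * n" using that by (intro mult_le_mono1) simp
      finally show ?thesis using that(1) by simp
    qed
    from runs_add_rows[OF lt eq(1)[symmetric]]
    show "runs add_rows s' (n * (18 * n + 18) + 6)
        (\<lambda>s''. ?I (Suc i) (s''\<lparr>regs := (regs s'')(''p'' := Suc i)\<rparr>))"
    proof (rule runs_mono)
      fix s''
      assume s'': "regs s'' ''m'' = regs s' ''m'' + n \<and>
        (\<forall>j<regs s' ''m''. cells s'' ''D'' j = cells s' ''D'' j) \<and>
        (\<forall>v<n. \<forall>u<n. cells s'' ''D'' (regs s' ''m'' + v) u =
           cells s' ''D'' (regs s' ''p'') u + cells s' ''E'' v u)"
      have "cells s'' ''D'' (M + p * n + v) u = cells s ''D'' p u + cells s ''E'' v u"
        if "p < Suc i" "v < n" "u < n" for p v u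
      proof (cases "p = i")
        case True
        then show ?thesis using s'' s' eq iM that by simp
      next
        case False
        then have "p < i" using that by simp
        then show ?thesis using old[of s'' p v] s'' s' that by simp
      qed
      then show "?I (Suc i) (s''\<lparr>regs := (regs s'')(''p'' := Suc i)\<rparr>)"
        using s'' s' iM by simp
    qed simp
  qed (use t assms in auto)
qed simp

definition small_nbhds :: "'a graph \<Rightarrow> nat \<Rightarrow> 'a set set" where
  "small_nbhds G k = {open_nbhd G S | S. S \<subseteq> verts G \<and> card S \<le> k}"

lemma small_nbhds_0: "finite (verts G) \<Longrightarrow> small_nbhds G 0 = {{}}"
  by (auto simp: small_nbhds_def open_nbhd_def dest: finite_subset)

lemma small_nbhds_Suc:
  assumes "finite (verts G)"
  shows "small_nbhds G (Suc k) =
    small_nbhds G k \<union> {R \<union> open_nbhd G {v} | R v. R \<in> small_nbhds G k \<and> v \<in> verts G}"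
proof (intro equalityI subsetI)
  fix X assume "X \<in> small_nbhds G (Suc k)"
  then obtain S where S: "S \<subseteq> verts G" "card S \<le> Suc k" "X = open_nbhd G S"
    by (auto simp: small_nbhds_def)
  show "X \<in> small_nbhds G k \<union> {R \<union> open_nbhd G {v} | R v. R \<in> small_nbhds G k \<and> v \<in> verts G}"
  proof (cases "card S \<le> k")
    case True
    then show ?thesis using S by (auto simp: small_nbhds_def)
  next
    case False
    then obtain v where v: "v \<in> S" by fastforce
    have "card (S - {v}) \<le> k" using S v by (simp add: card_Diff_singleton)
    then have "open_nbhd G (S - {v}) \<in> small_nbhds G k" using S by (auto simp: small_nbhds_def)
    moreover have "X = open_nbhd G (S - {v}) \<union> open_nbhd G {v}"
      using v S(3) by (auto simp: open_nbhd_def)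
    ultimately show ?thesis using v S(1) by blast
  qed
next
  fix X assume "X \<in> small_nbhds G k \<union> {R \<union> open_nbhd G {v} | R v. R \<in> small_nbhds G k \<and> v \<in> verts G}"
  then show "X \<in> small_nbhds G (Suc k)"
  proof
    assume "X \<in> small_nbhds G k"
    then show ?thesis by (force simp: small_nbhds_def)
  next
    assume "X \<in> {R \<union> open_nbhd G {v} | R v. R \<in> small_nbhds G k \<and> v \<in> verts G}"
    then obtain S v where S: "S \<subseteq> verts G" "card S \<le> k" "v \<in> verts G"
      "X = open_nbhd G S \<union> open_nbhd G {v}"
      by (auto simp: small_nbhds_def)
    have "card (insert v S) \<le> Suc k"
      using S finite_subset[OF S(1) assms] by (simp add: card_insert_if)
    moreover have "X = open_nbhd G (insert v S)" using S(4) by (auto simp: open_nbhd_def)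
    ultimately show ?thesis using S unfolding small_nbhds_def by blast
  qed
qed

text \<open>A common interface to the weighted and the unweighted input format, stable under all
  programs that leave \<open>n\<close> and \<open>E\<close> alone.\<close>

definition input_ok :: "nat graph \<Rightarrow> nat \<Rightarrow> state \<Rightarrow> bool" where
  "input_ok G n s \<longleftrightarrow> simple_graph G \<and> verts G = {..<n} \<and> regs s ''n'' = n \<and>
     (\<forall>u v. cells s ''E'' u v \<noteq> 0 \<longleftrightarrow> adj G u v)"

lemma input_ok_frame:
  "input_ok G n s \<Longrightarrow> frame c s s' \<Longrightarrow> ''n'' \<notin> written_regs c \<Longrightarrow> ''E'' \<notin> written_arrays c \<Longrightarrow>
    input_ok G n s'"
  by (simp add: input_ok_def frame_def)

text \<open>Rows are counted with repetition, so \<open>m\<close> is known exactly although distinct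
  sets may have the same neighbourhood.\<close>

definition enumerated :: "nat graph \<Rightarrow> nat \<Rightarrow> nat \<Rightarrow> state \<Rightarrow> bool" where
  "enumerated G n k s \<longleftrightarrow> regs s ''m'' = (n + 1) ^ k \<and> out_family n s = small_nbhds G k"

lemma out_family_stage:
  assumes G: "input_ok G n s" and m: "regs s' ''m'' = M + M * n" "M = regs s ''m''"
    and old: "\<forall>j<M. cells s' ''D'' j = cells s ''D'' j"
    and new: "\<forall>p<M. \<forall>v<n. \<forall>u<n. cells s' ''D'' (M + p * n + v) u = cells s ''D'' p u + cells s ''E'' v u"
  shows "out_family n s' =
    out_family n s \<union> {R \<union> open_nbhd G {v} | R v. R \<in> out_family n s \<and> v \<in> verts G}"
proof -
  let ?row = "\<lambda>s i. {v. v < n \<and> cells s ''D'' i v \<noteq> 0}"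
  have new': "?row s' (M + p * n + v) = ?row s p \<union> open_nbhd G {v}" if "p < M" "v < n" for p v
    using new that G by (auto simp: input_ok_def open_nbhd_def adj_sym dest: adj_verts)
  \<comment> \<open>Division with remainder by \<open>n\<close> recovers \<open>p\<close> and
    \<open>v\<close> from the index of a new row.\<close>
  have split: "{..<M + M * n} = {..<M} \<union> {M + p * n + v | p v. p < M \<and> v < n}"
  proof (intro equalityI subsetI)
    fix j assume j: "j \<in> {..<M + M * n}"
    show "j \<in> {..<M} \<union> {M + p * n + v | p v. p < M \<and> v < n}"
    proof (cases "j < M")
      case False
      then have "j - M < M * n" using j by auto
      then have "n > 0" "(j - M) div n < M"
        by (auto simp: less_mult_imp_div_less intro: gr0I)
      moreover have "j = M + (j - M) div n * n + (j - M) mod n" using False by simp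
      ultimately show ?thesis using mod_less_divisor by blast
    qed simp
  next
    fix j assume "j \<in> {..<M} \<union> {M + p * n + v | p v. p < M \<and> v < n}"
    then show "j \<in> {..<M + M * n}"
    proof
      assume "j \<in> {M + p * n + v | p v. p < M \<and> v < n}"
      then obtain p v where pv: "j = M + p * n + v" "p < M" "v < n" by blast
      have "p * n + v < Suc p * n" using pv by simp
      also have "\<dots> \<le> M * n" using pv by (intro mult_le_mono1) simp
      finally show ?thesis using pv by simp
    qed auto
  qed
  have "out_family n s' = ?row s' ` {..<M} \<union> ?row s' ` {M + p * n + v | p v. p < M \<and> v < n}"
    by (simp add: out_family_def m(1) split image_Un)
  also have "?row s' ` {..<M} = out_family n s"
    using old by (auto simp: out_family_def m(2))
  also have "?row s' ` {M + p * n + v | p v. p < M \<and> v < n} =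
      {?row s p \<union> open_nbhd G {v} | p v. p < M \<and> v < n}"
    using new' by (auto simp: image_iff) metis+
  also have "\<dots> = {R \<union> open_nbhd G {v} | R v. R \<in> out_family n s \<and> v \<in> verts G}"
    using G by (auto simp: out_family_def m(2) input_ok_def)
  finally show ?thesis .
qed

text \<open>Every stage is charged the price of the last and most expensive one. The base
  \<open>n + 2\<close> absorbs the additive constants and is at least 2 even for the empty
  graph.\<close>

lemma runs_stages:
  assumes "input_ok G n s" "enumerated G n j s"
  shows "runs (stages k) s (18 * (k + 1) * (n + 2) ^ (j + k + 2)) (enumerated G n (j + k))"
  using assms
proof (induction k arbitrary: j s)
  case 0
  have "1 \<le> 18 * (0 + 1) * (n + 2) ^ (j + 0 + 2)" using one_le_power[of "n + 2" "j + 2"] by simp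
  then show ?case using 0 by (auto intro!: runs_Skip)
next
  case (Suc k)
  define M where "M = (n + 1) ^ j"
  have m: "M = regs s ''m''" "n = regs s ''n''" "finite (verts G)"
    using Suc.prems by (auto simp: M_def enumerated_def input_ok_def)
  show ?case
    unfolding stages.simps
  proof (rule runs_Seq[OF runs_stage[OF m(1,2)]])
    fix s' assume s': "regs s' ''m'' = M + M * n \<and>
        (\<forall>j<M. cells s' ''D'' j = cells s ''D'' j) \<and>
        (\<forall>p<M. \<forall>v<n. \<forall>u<n. cells s' ''D'' (M + p * n + v) u =
           cells s ''D'' p u + cells s ''E'' v u)"
      and fr: "frame stage s s'"
    have "input_ok G n s'" using input_ok_frame[OF Suc.prems(1) fr] by simp
    moreover have "enumerated G n (Suc j) s'"
      using s' out_family_stage[OF Suc.prems(1) _ m(1), of s'] Suc.prems(2) m(3)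
      by (auto simp: enumerated_def small_nbhds_Suc M_def algebra_simps)
    ultimately show "runs (stages k) s' (18 * (k + 1) * (n + 2) ^ (Suc j + k + 2)) (enumerated G n (j + Suc k))"
      using Suc.IH[of s' "Suc j"] by simp
  next
    have "M \<ge> 1" by (simp add: M_def)
    have "M * (n * (18 * n + 18) + 14) + 8 \<le> M * (n * (18 * n + 18) + 14) + M * 8"
      using \<open>M \<ge> 1\<close> by simp
    also have "\<dots> = M * (n * (18 * n + 18) + 22)" by (simp add: algebra_simps)
    also have "\<dots> \<le> M * (18 * (n + 2) ^ 2)"
      by (intro mult_le_mono2) (simp add: power2_eq_square algebra_simps)
    also have "\<dots> \<le> (n + 2) ^ j * (18 * (n + 2) ^ 2)"
      unfolding M_def by (intro mult_le_mono1 power_mono) auto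
    also have "\<dots> = 18 * (n + 2) ^ (j + 2)" by (simp only: power_add mult_ac)
    also have "\<dots> \<le> 18 * (n + 2) ^ (j + Suc k + 2)"
      by (intro mult_le_mono2 power_increasing) auto
    finally have le: "M * (n * (18 * n + 18) + 14) + 8 \<le> 18 * (n + 2) ^ (j + Suc k + 2)" .
    have "18 * (Suc k + 1) * Z = 18 * Z + 18 * (k + 1) * Z" for Z :: nat
      by (simp add: algebra_simps)
    moreover have "Suc j + k + 2 = j + Suc k + 2" by simp
    ultimately show "M * (n * (18 * n + 18) + 14) + 8 + 18 * (k + 1) * (n + 2) ^ (Suc j + k + 2)
        \<le> 18 * (Suc k + 1) * (n + 2) ^ (j + Suc k + 2)"
      using le by (simp only: add_le_mono1)
  qed
qed

subsection \<open>Strong dispersers\<close>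

text \<open>After \<open>i\<close> rounds \<open>x\<close> is \<open>2 ^ i\<close>, and the loop
  stops once this exceeds \<open>n\<close>. Spending \<open>c\<close> stages per round reaches sets
  of size \<open>c * L\<close>, with \<open>L\<close> the binary length of \<open>n\<close>,
  although the program text contains only the constant \<open>c\<close>.\<close>

definition enumerate_log :: "nat \<Rightarrow> com" where
  "enumerate_log c = Seq (Assign ''m'' (Const 1)) (Seq (Assign ''x'' (Const 1))
     (While (Less (Var ''x'') (Add (Var ''n'') (Const 1)))
       (Seq (Assign ''x'' (Add (Var ''x'') (Var ''x''))) (stages c))))"

text \<open>In a blank array, row 0 already is the characteristic vector of the empty set; it only
  has to be declared by setting \<open>m\<close> to 1.\<close>

lemma enumerated_0:
  assumes "finite (verts G)" "regs s ''m'' = 1" "cells s ''D'' = (\<lambda>_ _. 0)"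
  shows "enumerated G n 0 s"
  using assms by (auto simp: enumerated_def small_nbhds_0 out_family_def)

lemma runs_enumerate_log:
  assumes G: "input_ok G n s" and D: "cells s ''D'' = (\<lambda>_ _. 0)"
    and L: "\<And>i. 2 ^ i \<le> n \<longleftrightarrow> i < L"
  shows "runs (enumerate_log c) s (L * (10 + 18 * (c + 1) * (n + 2) ^ (c * L + 2)) + 10)
    (enumerated G n (c * L))"
proof -
  let ?B = "18 * (c + 1) * (n + 2) ^ (c * L + 2)"
  let ?body = "Seq (Assign ''x'' (Add (Var ''x'') (Var ''x''))) (stages c)"
  let ?b = "Less (Var ''x'') (Add (Var ''n'') (Const 1))"
  have loop: "runs (While ?b ?body) s ((L - i) * (10 + ?B) + 6) (enumerated G n (c * L))"
    if "i \<le> L" "input_ok G n s" "enumerated G n (c * i) s" "regs s ''x'' = 2 ^ i" for i s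
    using that
  proof (induction "L - i" arbitrary: i s)
    case 0
    then have "i = L" by simp
    moreover have "\<not> 2 ^ L \<le> n" using L by simp
    ultimately show ?case
      using 0 by (intro runs_While_False) (auto simp: input_ok_def)
  next
    case (Suc k)
    then have lt: "i < L" by simp
    have LS: "L - i = Suc (L - Suc i)" using lt by simp
    let ?P = "\<lambda>t. input_ok G n t \<and> enumerated G n (c * Suc i) t \<and> regs t ''x'' = 2 ^ Suc i"
    show ?case
    proof (rule runs_While_True)
      show "bval s ?b" using L[of i] lt Suc by (auto simp: input_ok_def)
      show "runs ?body s (4 + ?B) ?P"
      proof (rule runs_Seq)
        let ?P1 = "\<lambda>t. input_ok G n t \<and> enumerated G n (c * i) t \<and> regs t ''x'' = 2 ^ Suc i"
        show "runs (Assign ''x'' (Add (Var ''x'') (Var ''x''))) s 4 ?P1"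
          using Suc by (intro runs_Assign) (auto simp: input_ok_def enumerated_def out_family_def)
        fix t assume t: "?P1 t"
        have "c * i + c + 2 \<le> c * L + 2"
          using lt mult_le_mono2[of "Suc i" L c] by simp
        then have "18 * (c + 1) * (n + 2) ^ (c * i + c + 2) \<le> ?B"
          by (intro mult_le_mono2 power_increasing) auto
        then show "runs (stages c) t ?B ?P"
        proof (rule runs_mono[rotated])
          show "runs (stages c) t (18 * (c + 1) * (n + 2) ^ (c * i + c + 2)) (enumerated G n (c * i + c))"
            using t by (intro runs_stages) auto
          fix t' assume t': "enumerated G n (c * i + c) t'" "frame (stages c) t t'"
          have "input_ok G n t'"
            using written_stages[of c] t by (intro input_ok_frame[OF _ t'(2)]) auto
          moreover have "regs t' ''x'' = 2 ^ Suc i"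
            using written_stages[of c] t frame_regs[OF t'(2), of "''x''"] by auto
          ultimately show "?P t'" using t'(1) by (simp add: add.commute)
        qed
      qed simp
      show "runs (While ?b ?body) t ((L - Suc i) * (10 + ?B) + 6) (enumerated G n (c * L))"
        if "?P t" for t
        using Suc.hyps(1)[of "Suc i" t] that lt Suc.hyps(2) by auto
      show "1 + bcost ?b + (4 + ?B) + ((L - Suc i) * (10 + ?B) + 6) \<le> (L - i) * (10 + ?B) + 6"
        by (simp add: LS)
    qed
  qed
  show ?thesis
    unfolding enumerate_log_def
  proof (rule runs_Seq)
    let ?P1 = "\<lambda>t. input_ok G n t \<and> enumerated G n 0 t"
    show "runs (Assign ''m'' (Const 1)) s 2 ?P1"
      using G D by (intro runs_Assign) (auto simp: input_ok_def intro!: enumerated_0)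
    fix t assume t: "?P1 t"
    show "runs (Seq (Assign ''x'' (Const 1)) (While ?b ?body)) t (2 + (L * (10 + ?B) + 6))
        (enumerated G n (c * L))"
    proof (rule runs_Seq)
      let ?P2 = "\<lambda>t. input_ok G n t \<and> enumerated G n 0 t \<and> regs t ''x'' = 1"
      show "runs (Assign ''x'' (Const 1)) t 2 ?P2"
        using t by (intro runs_Assign) (auto simp: input_ok_def enumerated_def out_family_def)
      show "runs (While ?b ?body) u (L * (10 + ?B) + 6) (enumerated G n (c * L))" if "?P2 u" for u
        using loop[of 0 u] that by simp
    qed simp
  qed simp
qed

section \<open>Bounds in terms of log n\<close>

lemma binary_length_exists:
  obtains L where "\<And>i. 2 ^ i \<le> n \<longleftrightarrow> i < L" "real L \<le> log 2 (real n) + 1"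
proof -
  define L where "L = (LEAST i. n < 2 ^ i)"
  have ex: "n < 2 ^ n" by simp
  then have "n < 2 ^ L" unfolding L_def by (rule LeastI)
  have *: "2 ^ i \<le> n \<longleftrightarrow> i < L" for i
  proof
    assume le: "2 ^ i \<le> n"
    show "i < L"
    proof (rule ccontr)
      assume "\<not> i < L"
      then have "(2::nat) ^ L \<le> 2 ^ i" by (intro power_increasing) auto
      then show False using le \<open>n < 2 ^ L\<close> by linarith
    qed
  next
    assume "i < L"
    then show "2 ^ i \<le> n" unfolding L_def using not_less_Least by (metis not_le)
  qed
  have "real L \<le> log 2 (real n) + 1"
  proof (cases L)
    case 0
    then show ?thesis by (cases "n = 0") (auto simp: log_def)
  next
    case (Suc l)
    then have "2 ^ l \<le> n" using * by simp
    then have "(2::real) ^ l \<le> real n" by (metis of_nat_le_iff of_nat_numeral of_nat_power)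
    then have "log 2 (2 ^ l) \<le> log 2 (real n)" by (intro log_mono) auto
    then show ?thesis using Suc by (simp add: log_nat_power)
  qed
  with * show ?thesis by (rule that)
qed

text \<open>About \<open>1 / \<beta>\<close> factors \<open>1 - \<beta>\<close> give at most 1/e,
  hence at most 1/2; \<open>L\<close> such groups give at most \<open>2 ^ (- L)\<close>, which is
  below 1/n for positive n.\<close>

lemma power_ceiling_lt_1:
  fixes \<beta> :: real
  assumes \<beta>: "0 < \<beta>" "\<beta> \<le> 1" and n: "n < 2 ^ L"
  shows "(1 - \<beta>) ^ (nat \<lceil>1 / \<beta>\<rceil> * L) * real n < 1"
proof -
  let ?r = "nat \<lceil>1 / \<beta>\<rceil>"
  have "1 / \<beta> \<le> real ?r" by linarith
  then have "1 / \<beta> * \<beta> \<le> real ?r * \<beta>" using \<beta> by (intro mult_right_mono) auto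
  then have r: "1 \<le> real ?r * \<beta>" using \<beta> by simp
  have "(1 - \<beta>) ^ ?r \<le> exp (- \<beta>) ^ ?r"
    using \<beta> exp_ge_add_one_self[of "- \<beta>"] by (intro power_mono) auto
  also have "\<dots> = exp (- (real ?r * \<beta>))" by (simp only: exp_of_nat_mult[symmetric] mult_minus_right)
  also have "\<dots> \<le> exp (- 1)" using r by (simp only: exp_le_cancel_iff neg_le_iff_le)
  also have "\<dots> \<le> 1 / 2" using exp_ge_add_one_self[of 1] by (simp add: exp_minus field_simps)
  finally have "(1 - \<beta>) ^ ?r \<le> 1 / 2" .
  then have "((1 - \<beta>) ^ ?r) ^ L \<le> (1 / 2) ^ L" using \<beta> by (intro power_mono) auto
  then have "(1 - \<beta>) ^ (?r * L) * real n \<le> (1 / 2) ^ L * real n"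
    by (intro mult_right_mono) (auto simp: power_mult)
  also have "\<dots> < (1 / 2) ^ L * 2 ^ L"
  proof -
    have "real n < 2 ^ L" using n by (metis of_nat_less_iff of_nat_numeral of_nat_power)
    then show ?thesis by (intro mult_strict_left_mono) auto
  qed
  also have "\<dots> = 1" by (simp add: power_divide)
  finally show ?thesis .
qed

text \<open>The covering takes the ceiling of \<open>2 * T / \<gamma>\<close> times \<open>L\<close>
  vertices and the separator takes \<open>T\<close>. An independent set of positive weight forces
  \<open>n \<ge> 1\<close>, so \<open>L \<ge> 1\<close> and \<open>T \<le> T * L\<close>; this
  brings the sum into the form \<open>c * L\<close> that the enumeration reaches.\<close>

lemma strong_disperser_small_nbhds:
  fixes G :: "nat graph"
  assumes G: "simple_graph G" "verts G = {..<n}" and T: "T \<ge> 1"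
    and free: "\<And>l. l \<ge> T \<Longrightarrow> \<not> has_induced G (cycle_graph l)"
    and \<gamma>: "0 < \<gamma>" "\<gamma> < 1 / 2" and L: "\<And>i. 2 ^ i \<le> n \<longleftrightarrow> i < L"
  shows "strong_disperser G w \<gamma> (1 / 4) (small_nbhds G ((nat \<lceil>2 * real T / \<gamma>\<rceil> + T) * L))"
  unfolding strong_disperser_def
proof (intro conjI allI impI ballI)
  fix X assume "X \<in> small_nbhds G ((nat \<lceil>2 * real T / \<gamma>\<rceil> + T) * L)"
  then show "X \<subseteq> verts G" using open_nbhd_subset[OF G(1)] by (auto simp: small_nbhds_def)
next
  fix I assume I: "independent G I \<and> 0 < sum w I"
  let ?r = "nat \<lceil>2 * real T / \<gamma>\<rceil>"
  have "n \<noteq> 0"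
  proof
    assume "n = 0"
    then have "I = {}" using I G(2) by (auto simp: independent_def)
    then show False using I by simp
  qed
  then have "n \<ge> 1" by simp
  then have "L \<ge> 1" using L[of 0] by simp
  have n: "n < 2 ^ L" using L[of L] by simp
  have "\<gamma> / (2 * real T) \<le> 1"
  proof -
    have "\<gamma> \<le> 2 * real T" using \<gamma> T by linarith
    then show ?thesis using T by simp
  qed
  then have "(1 - \<gamma> / (2 * real T)) ^ (?r * L) * real n < 1"
    using power_ceiling_lt_1[of "\<gamma> / (2 * real T)" n L] n \<gamma> T by simp
  then obtain S where S: "S \<subseteq> verts G" "card S \<le> ?r * L + T"
    "good_set G (restrict_weight w I) \<gamma> (1 / 4) (open_nbhd G S)"
    using good_open_nbhd_exists[OF G(1) T free, of I w \<gamma> "?r * L"] I \<gamma> G(2) by auto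
  have "T \<le> T * L" using \<open>L \<ge> 1\<close> by simp
  then have "card S \<le> (?r + T) * L" using S(2) unfolding add_mult_distrib by linarith
  then show "\<exists>X\<in>small_nbhds G ((?r + T) * L). good_set G (restrict_weight w I) \<gamma> (1 / 4) X"
    using S by (auto simp: small_nbhds_def)
qed

text \<open>All factors are turned into powers of the base, which is at least 2:
  \<open>k + 1 \<le> 2 ^ k\<close> disposes of \<open>L + 1\<close> and \<open>c + 1\<close>, and
  the constant 28 = 10 + 18 is below \<open>2 ^ 5\<close>. A single power is easily rewritten with
  base 2.\<close>

lemma enumerate_log_time:
  shows "L * (10 + 18 * (c + 1) * (n + 2) ^ (c * L + 2)) + 10 \<le> (n + 2) ^ ((L + 1) * (c + 1) + 6)"
proof -
  let ?N = "n + 2" and ?P = "(n + 2) ^ (c * L + 2)"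
  have two: "2 ^ k \<le> ?N ^ k" for k by (intro power_mono) auto
  have suc: "k + 1 \<le> ?N ^ k" for k
  proof -
    have "k < 2 ^ k" by simp
    then show ?thesis using two[of k] by linarith
  qed
  define P where "P = ?P"
  have "1 \<le> P" unfolding P_def by (intro one_le_power) simp
  then have P: "1 \<le> (c + 1) * P" by simp
  have "L * (10 + 18 * (c + 1) * P) + 10 = 10 * (L + 1) + 18 * L * ((c + 1) * P)"
    by (simp add: algebra_simps)
  also have "\<dots> \<le> 10 * (L + 1) * ((c + 1) * P) + 18 * (L + 1) * ((c + 1) * P)"
  proof (rule add_mono)
    show "10 * (L + 1) \<le> 10 * (L + 1) * ((c + 1) * P)"
      using mult_le_mono2[OF P, of "10 * (L + 1)"] by (simp only: mult_1_right)
    show "18 * L * ((c + 1) * P) \<le> 18 * (L + 1) * ((c + 1) * P)" by (intro mult_le_mono1) simp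
  qed
  also have "\<dots> = 28 * ((L + 1) * ((c + 1) * P))" by (simp add: algebra_simps)
  also have "\<dots> \<le> ?N ^ 5 * (?N ^ L * (?N ^ c * P))"
  proof -
    have "(28 :: nat) \<le> 2 ^ 5" by simp
    then have "28 \<le> ?N ^ 5" using two[of 5] by (rule le_trans)
    then show ?thesis using suc by (intro mult_le_mono) auto
  qed
  also have "\<dots> = ?N ^ (5 + (L + (c + (c * L + 2))))" unfolding P_def by (simp only: power_add)
  also have "5 + (L + (c + (c * L + 2))) = (L + 1) * (c + 1) + 6" by (simp add: algebra_simps)
  finally have "L * (10 + 18 * (c + 1) * P) + 10 \<le> ?N ^ ((L + 1) * (c + 1) + 6)" .
  then show ?thesis unfolding P_def .
qed

lemma poly2_mult: "poly2 (p * q) x y = poly2 p x y * poly2 q x y"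
  and poly2_add: "poly2 (p + q) x y = poly2 p x y + poly2 q x y"
  by (simp_all add: poly2_def)

text \<open>The outer variable is \<open>log n\<close>, the inner one \<open>\<gamma>\<^sup>-\<^sup>1\<close>.\<close>

definition disperser_bound :: "nat \<Rightarrow> real poly poly" where
  "disperser_bound T = [:[:2:], 1:] * ([:[:2:], 1:] * [:[:real T + 2, 2 * real T:]:] + [:[:6:]:])"

lemma poly2_disperser_bound:
  "poly2 (disperser_bound T) x y = (x + 2) * ((x + 2) * (real T + 2 + 2 * real T * y) + 6)"
  unfolding disperser_bound_def poly2_mult poly2_add by (simp add: poly2_def algebra_simps)

lemma enumerate_log_bound:
  assumes L: "real L \<le> log 2 (real n) + 1" and \<gamma>: "0 < \<gamma>"
  shows "real ((n + 2) ^ ((L + 1) * (nat \<lceil>2 * real T / \<gamma>\<rceil> + T + 1) + 6))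
    \<le> 2 powr poly2 (disperser_bound T) (log 2 (real n)) (inverse \<gamma>)"
proof -
  let ?c = "nat \<lceil>2 * real T / \<gamma>\<rceil> + T" and ?x = "log 2 (real n)"
  have x0: "0 \<le> ?x" by (cases "n = 0") (auto simp: log_def)
  \<comment> \<open>For positive \<open>n\<close> this is \<open>n + 2 \<le> 4 * n\<close>; for
    \<open>n = 0\<close> the left side is 1 and \<open>log 2 0 = 0\<close>.\<close>
  have x: "log 2 (real (n + 2)) \<le> ?x + 2"
  proof (cases "n = 0")
    case False
    then have "log 2 (real (n + 2)) \<le> log 2 (4 * real n)" by (intro log_mono) auto
    also have "\<dots> = log 2 (2 ^ 2) + ?x" using False by (simp add: log_mult)
    also have "log 2 ((2::real) ^ 2) = 2" by (subst log_nat_power) auto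
    finally show ?thesis by simp
  qed (simp add: log_def)
  have "0 \<le> 2 * real T / \<gamma>" using \<gamma> by simp
  then have "real (nat \<lceil>2 * real T / \<gamma>\<rceil>) \<le> 2 * real T / \<gamma> + 1" by linarith
  \<comment> \<open>One unit of \<open>T + 2\<close> pays for rounding up, the other for the
    explicit \<open>+ 1\<close>.\<close>
  then have c: "real ?c + 1 \<le> real T + 2 + 2 * real T * inverse \<gamma>" by (simp add: field_simps)
  have "real ((L + 1) * (?c + 1) + 6) = (real L + 1) * (real ?c + 1) + 6" by (simp add: algebra_simps)
  also have "\<dots> \<le> (?x + 2) * (real T + 2 + 2 * real T * inverse \<gamma>) + 6"
    using L c x0 by (intro add_right_mono mult_mono) auto
  finally have e: "real ((L + 1) * (?c + 1) + 6) \<le> (?x + 2) * (real T + 2 + 2 * real T * inverse \<gamma>) + 6" .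
  have "real ((n + 2) ^ ((L + 1) * (?c + 1) + 6)) =
      (2 powr log 2 (real (n + 2))) powr real ((L + 1) * (?c + 1) + 6)"
    by (subst powr_log_cancel) (auto simp: powr_realpow simp del: of_nat_add of_nat_mult)
  also have "\<dots> = 2 powr (log 2 (real (n + 2)) * real ((L + 1) * (?c + 1) + 6))"
    by (rule powr_powr)
  also have "\<dots> \<le> 2 powr ((?x + 2) * ((?x + 2) * (real T + 2 + 2 * real T * inverse \<gamma>) + 6))"
    using x x0 e by (intro powr_mono mult_mono) auto
  finally show ?thesis by (simp add: poly2_disperser_bound)
qed

lemma input_ok_weighted_graph_input:
  "simple_graph G \<Longrightarrow> verts G = {..<n} \<Longrightarrow> input_ok G n (weighted_graph_input G w)"
  by (auto simp: input_ok_def weighted_graph_input_def graph_input_def)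

text \<open>The class excludes cycles of length at least both \<open>t\<close> and 3;
  \<open>t + 3\<close> is a single threshold beyond both, and it is positive as the separator
  requires.\<close>

lemma long_cycle_free_shift:
  "G \<in> long_cycle_free t \<Longrightarrow> simple_graph G"
  "G \<in> long_cycle_free t \<Longrightarrow> l \<ge> t + 3 \<Longrightarrow> \<not> has_induced G (cycle_graph l)"
  by (auto simp: long_cycle_free_def)

lemma quarter_program:
  "\<exists>T s'. exec (Seq (Assign ''num'' (Const 1)) (Assign ''den'' (Const 4))) s T s' \<and>
    real T \<le> poly [:4:] x \<and> out_fraction s' (1 / 4)"
proof -
  have "runs (Seq (Assign ''num'' (Const 1)) (Assign ''den'' (Const 4))) s 4 (\<lambda>s'. out_fraction s' (1 / 4))"
    by (rule runs_Seq[of _ _ 2 "\<lambda>t. regs t ''num'' = 1" _ 2]; (rule runs_Assign)?)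
      (auto simp: out_fraction_def)
  then show ?thesis unfolding runs_def by force
qed

lemma strongly_QP_dispersible_long_cycle_free: "strongly_QP_dispersible (long_cycle_free t)"
  unfolding strongly_QP_dispersible_def
proof (intro conjI hereditary_long_cycle_free exI[of _ "disperser_bound (t + 3)"]
    exI[of _ "\<lambda>_ _. 1 / 4"] allI impI)
  let ?T = "t + 3"
  show "poly_time_from_rational (\<lambda>_ _. 1 / 4)"
    unfolding poly_time_from_rational_def using quarter_program by blast
  show "poly_time_fixed (\<lambda>_. 1 / 4)"
    unfolding poly_time_fixed_def using quarter_program by blast
  show "antimono (\<lambda>_::nat. 1 / 4 :: real)" by (simp add: antimono_def)
  fix \<gamma> :: real assume \<gamma>: "0 < \<gamma> \<and> \<gamma> < 1 / 2"
  show "(0::real) < 1 / 4" "(1::real) / 4 < 1 / 2" by auto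
  show "inverse (1 / 4) \<le> poly2 (disperser_bound ?T) (log 2 (real n)) (inverse \<gamma>)" for n
  proof -
    have x0: "0 \<le> log 2 (real n)" by (cases "n = 0") (auto simp: log_def)
    have "(2::real) * (2 * 0 + 6) \<le> poly2 (disperser_bound ?T) (log 2 (real n)) (inverse \<gamma>)"
      unfolding poly2_disperser_bound using x0 \<gamma> by (intro mult_mono add_mono) auto
    then show ?thesis by simp
  qed
  \<comment> \<open>\<gamma> enters the program only through this number, which is fixed before
    \<open>n\<close>, the graph and the weights.\<close>
  let ?c = "nat \<lceil>2 * real ?T / \<gamma>\<rceil> + ?T"
  show "\<exists>c. \<forall>n G w. G \<in> long_cycle_free t \<and> verts G = {..<n} \<longrightarrow>
      (\<exists>T s. exec c (weighted_graph_input G w) T s \<and>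
        real T \<le> 2 powr poly2 (disperser_bound ?T) (log 2 (real n)) (inverse \<gamma>) \<and>
        real (regs s ''m'') \<le> 2 powr poly2 (disperser_bound ?T) (log 2 (real n)) (inverse \<gamma>) \<and>
        strong_disperser G w \<gamma> (1 / 4) (out_family n s))"
  proof (intro exI[of _ "enumerate_log ?c"] allI impI)
    fix n G w assume G: "G \<in> long_cycle_free t \<and> verts G = {..<n}"
    then have simple: "simple_graph G" using long_cycle_free_shift by blast
    obtain L where L: "\<And>i. 2 ^ i \<le> n \<longleftrightarrow> i < L" "real L \<le> log 2 (real n) + 1"
      using binary_length_exists[of n] by blast
    let ?e = "(L + 1) * (?c + 1) + 6"
    have bound: "real k \<le> 2 powr poly2 (disperser_bound ?T) (log 2 (real n)) (inverse \<gamma>)"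
      if "k \<le> (n + 2) ^ ?e" for k
      using enumerate_log_bound[OF L(2), of \<gamma> ?T] \<gamma> that
      by (meson of_nat_le_iff order_trans)
    have ok: "input_ok G n (weighted_graph_input G w)"
      using simple G input_ok_weighted_graph_input by blast
    have "cells (weighted_graph_input G w) ''D'' = (\<lambda>_ _. 0)"
      by (simp add: weighted_graph_input_def graph_input_def)
    from runs_enumerate_log[OF ok this L(1), of ?c] obtain T s where run:
      "exec (enumerate_log ?c) (weighted_graph_input G w) T s"
      "T \<le> L * (10 + 18 * (?c + 1) * (n + 2) ^ (?c * L + 2)) + 10" "enumerated G n (?c * L) s"
      unfolding runs_def by blast
    have "T \<le> (n + 2) ^ ?e" using run(2) enumerate_log_time[of L ?c n] by (rule le_trans)
    moreover have "regs s ''m'' \<le> (n + 2) ^ ?e"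
    proof -
      have "(n + 1) ^ (?c * L) \<le> (n + 2) ^ (?c * L)" by (intro power_mono) auto
      also have "\<dots> \<le> (n + 2) ^ ?e"
        by (intro power_increasing) (auto simp: algebra_simps)
      finally show ?thesis using run(3) by (simp add: enumerated_def)
    qed
    moreover have "strong_disperser G w \<gamma> (1 / 4) (small_nbhds G (?c * L))"
      by (rule strong_disperser_small_nbhds[OF simple _ _ long_cycle_free_shift(2) _ _ L(1)])
        (use G \<gamma> in auto)
    then have "strong_disperser G w \<gamma> (1 / 4) (out_family n s)"
      using run(3) by (simp add: enumerated_def)
    ultimately show "\<exists>T s. exec (enumerate_log ?c) (weighted_graph_input G w) T s \<and>
        real T \<le> 2 powr poly2 (disperser_bound ?T) (log 2 (real n)) (inverse \<gamma>) \<and>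
        real (regs s ''m'') \<le> 2 powr poly2 (disperser_bound ?T) (log 2 (real n)) (inverse \<gamma>) \<and>
        strong_disperser G w \<gamma> (1 / 4) (out_family n s)"
      using run(1) bound by blast
  qed
qed

subsection \<open>Uniform dispersers\<close>

text \<open>All that an edgeless pattern asks of the classes: no edge of the remaining graph joins
  two of them, and each has at most half of the vertices. Labels below \<open>n\<close> can serve as
  pattern vertices.\<close>

definition separated :: "nat graph \<Rightarrow> nat \<Rightarrow> nat set \<Rightarrow> (nat \<Rightarrow> nat) \<Rightarrow> bool" where
  "separated G n X l \<longleftrightarrow> (\<forall>x<n. l x < n) \<and>
     (\<forall>x<n. \<forall>y<n. x \<notin> X \<and> y \<notin> X \<and> adj G x y \<longrightarrow> l x = l y) \<and>
     (\<forall>a<n. 2 * card {x. x < n \<and> x \<notin> X \<and> l x = a} \<le> n)"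

text \<open>Three equal entries of \<open>L\<close> encode a one-element object, so each remaining
  vertex is assigned to a vertex of the pattern.\<close>

definition valid_output :: "nat graph \<Rightarrow> nat \<Rightarrow> nat \<Rightarrow> state \<Rightarrow> bool" where
  "valid_output G n k s \<longleftrightarrow> out_set n s \<in> small_nbhds G k \<and>
     (\<forall>x<n. cells s ''L'' x 1 = cells s ''L'' x 0 \<and> cells s ''L'' x 2 = cells s ''L'' x 0) \<and>
     separated G n (out_set n s) (\<lambda>x. cells s ''L'' x 0)"

lemma edgeless_out_pattern:
  assumes "cells s ''H'' = (\<lambda>_ _. 0)"
  shows "verts (out_pattern s) = {..<regs s ''h''}" "edges (out_pattern s) = {}"
    "triangles (out_pattern s) = {}" "objects (out_pattern s) = (\<lambda>v. {v}) ` {..<regs s ''h''}"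
proof -
  show V: "verts (out_pattern s) = {..<regs s ''h''}" and E: "edges (out_pattern s) = {}"
    using assms by (auto simp: out_pattern_def)
  show T: "triangles (out_pattern s) = {}"
  proof (rule equals0I)
    fix T assume T: "T \<in> triangles (out_pattern s)"
    then have "card T = 3" by (simp add: triangles_def)
    then obtain u v where "u \<in> T" "v \<in> T" "u \<noteq> v"
      by (auto simp: card_3_iff)
    then show False using T E by (auto simp: triangles_def adj_def)
  qed
  show "objects (out_pattern s) = (\<lambda>v. {v}) ` {..<regs s ''h''}"
    by (simp add: objects_def V E T)
qed

text \<open>With no edges and no triangles in the pattern, the atoms are the label classes. Write r
  for the square root of n. The degree bound gives
  \<open>card X \<le> T * (r / (2 * T)) = r / 2\<close>, and the complement of an atom has at least
  \<open>n / 2 = r * (r / 2)\<close> vertices. The bound \<open>n \<ge> 4\<close> means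
  \<open>r \<ge> 2\<close>, hence \<open>n / 2 \<le> n - r\<close>, which is the second
  inequality.\<close>

lemma uniform_disperser_valid_output:
  assumes G: "simple_graph G" "verts G = {..<n}" and n: "n \<ge> 4" and T: "T \<ge> 1"
    and deg: "\<forall>v\<in>verts G. real (card (closed_nbhd G v)) \<le> 1 / (2 * real T) * real n powr (1 / 2)"
    and s: "regs s ''h'' = n" "cells s ''H'' = (\<lambda>_ _. 0)" "valid_output G n T s"
  shows "uniform_disperser (1 / 2) G (out_set n s) (out_pattern s) (out_eta n s) (out_iota n s)"
proof -
  let ?H = "out_pattern s" and ?X = "out_set n s" and ?l = "\<lambda>x. cells s ''L'' x 0"
  note H = edgeless_out_pattern[OF s(2)]
  have eta: "out_eta n s {v} = {x. x < n \<and> x \<notin> ?X \<and> ?l x = v}" for v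
    using s(3) by (auto simp: out_eta_def valid_output_def)
  have lab: "?l x < n" if "x < n" for x using s(3) that by (auto simp: valid_output_def separated_def)
  have XV: "?X \<subseteq> verts G" using G(2) by (auto simp: out_set_def)
  define r where "r = real n powr (1 / 2)"
  have r: "r > 0" "r * r = real n" using n by (auto simp: r_def powr_add[symmetric])
  have r2: "r \<ge> 2"
  proof (rule ccontr)
    assume "\<not> r \<ge> 2"
    then have "r * r < 2 * 2" using r by (intro mult_strict_mono) auto
    then show False using r n by simp
  qed
  have rn: "real n powr (- (1 / 2)) = 1 / r" unfolding r_def powr_minus by (simp add: field_simps)
  have cardX: "real (card ?X) \<le> r / 2"
  proof -
    obtain S where S: "S \<subseteq> verts G" "card S \<le> T" "?X = open_nbhd G S"
      using s(3) by (auto simp: valid_output_def small_nbhds_def)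
    have "real (card ?X) \<le> real T * (1 / (2 * real T) * r)"
      unfolding S(3) r_def by (rule card_open_nbhd_le[OF G(1) S(1,2) _ deg]) simp
    then show ?thesis using T by simp
  qed
  show ?thesis
    unfolding uniform_disperser_def
  proof (intro conjI ballI)
    show "?X \<subseteq> verts G" by (rule XV)
    show "extended_strip_decomposition (delete_verts G ?X) ?H (out_eta n s) (out_iota n s)"
      unfolding extended_strip_decomposition_def H
    proof (intro conjI)
      show "simple_graph ?H" by (simp add: simple_graph_def H)
      show "{..<regs s ''h''} \<noteq> {}" using s(1) n by (auto simp: lessThan_empty_iff)
      show "disjoint_family_on (out_eta n s) ((\<lambda>v. {v}) ` {..<regs s ''h''})"
        by (auto simp: disjoint_family_on_def eta)
      show "(\<Union>z\<in>(\<lambda>v. {v}) ` {..<regs s ''h''}. out_eta n s z) = verts (delete_verts G ?X)"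
        using lab s(1) by (auto simp: eta delete_verts_def verts_induced G(2))
      show "\<forall>d\<in>edges (delete_verts G ?X). \<exists>x y. d = {x, y} \<and>
        ((\<exists>z\<in>(\<lambda>v. {v}) ` {..<regs s ''h''}. x \<in> out_eta n s z \<and> y \<in> out_eta n s z) \<or>
         (\<exists>e\<in>{}. \<exists>f\<in>{}. \<exists>v\<in>e \<inter> f. e \<noteq> f \<and> x \<in> out_iota n s e v \<and> y \<in> out_iota n s f v) \<or>
         (\<exists>e\<in>{}. \<exists>v\<in>e. x \<in> out_eta n s {v} \<and> y \<in> out_iota n s e v) \<or>
         (\<exists>T\<in>{}. \<exists>u v. {u, v} \<in> {} \<and> {u, v} \<subseteq> T \<and>
            x \<in> out_eta n s T \<and> y \<in> out_iota n s {u, v} u \<inter> out_iota n s {u, v} v))"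
      proof
        fix d assume d: "d \<in> edges (delete_verts G ?X)"
        then have dG: "d \<in> edges G" "d \<subseteq> verts G - ?X" by (auto simp: delete_verts_def induced_def)
        then obtain x y where xy: "d = {x, y}" using G(1) by (auto simp: simple_graph_def card_2_iff)
        have mem: "x < n" "y < n" "x \<notin> ?X" "y \<notin> ?X" "adj G x y"
          using dG xy G(2) by (auto simp: adj_def)
        then have "?l x = ?l y" using s(3) by (auto simp: valid_output_def separated_def)
        then have "x \<in> out_eta n s {?l x} \<and> y \<in> out_eta n s {?l x}" using mem by (simp add: eta)
        moreover have "{?l x} \<in> (\<lambda>v. {v}) ` {..<regs s ''h''}" using lab mem s(1) by simp
        ultimately show "\<exists>x y. d = {x, y} \<and>
        ((\<exists>z\<in>(\<lambda>v. {v}) ` {..<regs s ''h''}. x \<in> out_eta n s z \<and> y \<in> out_eta n s z) \<or>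
         (\<exists>e\<in>{}. \<exists>f\<in>{}. \<exists>v\<in>e \<inter> f. e \<noteq> f \<and> x \<in> out_iota n s e v \<and> y \<in> out_iota n s f v) \<or>
         (\<exists>e\<in>{}. \<exists>v\<in>e. x \<in> out_eta n s {v} \<and> y \<in> out_iota n s e v) \<or>
         (\<exists>T\<in>{}. \<exists>u v. {u, v} \<in> {} \<and> {u, v} \<subseteq> T \<and>
            x \<in> out_eta n s T \<and> y \<in> out_iota n s {u, v} u \<inter> out_iota n s {u, v} v))"
          using xy by blast
      qed
    qed auto
    fix A assume "A \<in> atoms ?H (out_eta n s) (out_iota n s)"
    then obtain v where v: "v < n" "A = {x. x < n \<and> x \<notin> ?X \<and> ?l x = v}"
      using s(1) by (auto simp: atoms_def H eta)
    then have "2 * card A \<le> n" using s(3) by (simp add: valid_output_def separated_def)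
    then have A: "2 * real (card A) \<le> real n" by linarith
    have AV: "A \<subseteq> verts G" using v G(2) by auto
    have "real (card (verts G - A)) = real n - real (card A)"
      using AV G(2) card_mono[of "verts G" A] by (simp add: card_Diff_subset finite_subset of_nat_diff)
    then have "r / 2 * r \<le> real (card (verts G - A))" using A r by (simp add: field_simps)
    then have "r / 2 \<le> 1 / r * real (card (verts G - A))" using r(1) by (simp add: field_simps)
    with cardX have "real (card ?X) \<le> 1 / r * real (card (verts G - A))" by (rule order_trans)
    then show "real (card ?X) \<le> real (card (verts G)) powr - (1 / 2) * real (card (verts G - A))"
      using G(2) rn by simp
    have "2 * r \<le> r * r" using r2 by (intro mult_right_mono) auto
    then show "real (card A) \<le> real (card (verts G)) - real (card (verts G)) powr (1 / 2)"
      using A G(2) r by (simp add: r_def[symmetric])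
  qed
qed

text \<open>Invariant of the component computation: \<open>P\<close> consists of the pairs processed so far.\<close>

definition labelling :: "nat graph \<Rightarrow> nat \<Rightarrow> nat set \<Rightarrow> (nat \<Rightarrow> nat) \<Rightarrow> (nat \<times> nat) set \<Rightarrow> bool" where
  "labelling G n W l P \<longleftrightarrow> (\<forall>x<n. l x < n) \<and>
     (\<forall>x\<in>W. \<forall>y\<in>W. l x = l y \<longrightarrow> (x, y) \<in> (adj_in G W)\<^sup>*) \<and>
     (\<forall>x\<in>W. \<forall>y\<in>W. (x, y) \<in> P \<and> adj G x y \<longrightarrow> l x = l y)"

lemma labelling_init:
  "W \<subseteq> {..<n} \<Longrightarrow> \<forall>x<n. l x = x \<Longrightarrow> labelling G n W l {}"
  by (auto simp: labelling_def subset_iff)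

lemma labelling_skip:
  "labelling G n W l P \<Longrightarrow> \<not> (u \<in> W \<and> v \<in> W \<and> adj G u v) \<Longrightarrow> labelling G n W l (insert (u, v) P)"
  by (auto simp: labelling_def)

text \<open>Renaming a whole class keeps equal labels equal, so the pairs processed before stay
  satisfied. Two vertices that become equal only now are joined by a walk through the edge
  \<open>u v\<close>. Deleted vertices may be renamed as well, but the invariant asks of them only a
  label below \<open>n\<close>.\<close>

lemma labelling_merge:
  assumes l: "labelling G n W l P" and W: "W \<subseteq> {..<n}" and uv: "u \<in> W" "v \<in> W" "adj G u v"
    and l': "\<forall>x<n. l' x = (if l x = l u then l v else l x)"
  shows "labelling G n W l' (insert (u, v) P)"
proof -
  have same: "(x, y) \<in> (adj_in G W)\<^sup>*" if "x \<in> W" "y \<in> W" "l x = l y" for x y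
    using l that by (auto simp: labelling_def)
  have edge: "(u, v) \<in> (adj_in G W)\<^sup>*" using uv by (auto simp: adj_in_def)
  have l'W: "l' x = (if l x = l u then l v else l x)" if "x \<in> W" for x using W l' that by auto
  have cross: "(x, y) \<in> (adj_in G W)\<^sup>*" if "x \<in> W" "y \<in> W" "l x = l u" "l y = l v" for x y
    using rtrancl_trans[OF rtrancl_trans[OF same[of x u] edge] same[of v y]] that uv by simp
  have "(x, y) \<in> (adj_in G W)\<^sup>*" if xy: "x \<in> W" "y \<in> W" "l' x = l' y" for x y
  proof (cases "l x = l u"; cases "l y = l u")
    assume "l x = l u" "l y = l u"
    then show ?thesis using same xy by simp
  next
    assume "l x = l u" "l y \<noteq> l u"
    then show ?thesis using cross[of x y] xy l'W by simp
  next
    assume "l x \<noteq> l u" "l y = l u"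
    then show ?thesis using cross[of y x] xy l'W adj_in_rtrancl_sym[of y x] by simp
  next
    assume "l x \<noteq> l u" "l y \<noteq> l u"
    then show ?thesis using same xy l'W by simp
  qed
  moreover have "l' x < n" if "x < n" for x
    using l l' that uv W by (auto simp: labelling_def)
  moreover have "l' x = l' y" if "x \<in> W" "y \<in> W" "(x, y) \<in> insert (u, v) P" "adj G x y" for x y
    using that l l'W by (auto simp: labelling_def)
  ultimately show ?thesis by (auto simp: labelling_def)
qed

section \<open>Programs that compute and test the label classes\<close>

definition equal_test :: "aexp \<Rightarrow> aexp \<Rightarrow> bexp" where
  "equal_test a b = BAnd (BNot (Less a b)) (BNot (Less b a))"

lemma bval_equal_test [simp]: "bval s (equal_test a b) \<longleftrightarrow> aval s a = aval s b"
  by (auto simp: equal_test_def)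

lemma bcost_equal_test [simp]: "bcost (equal_test a b) = 5 + 2 * acost a + 2 * acost b"
  by (simp add: equal_test_def)

definition init_labels :: com where
  "init_labels = For ''x'' ''n'' (Store ''C'' (Var ''x'') (Const 0) (Var ''x''))"

text \<open>The two labels come from registers and not from the cells of \<open>u\<close> and
  \<open>v\<close>, because the pass overwrites the cell of \<open>u\<close> before it is
  finished.\<close>

definition relabel :: com where
  "relabel = For ''x'' ''n'' (Cond (equal_test (Cell ''C'' (Var ''x'') (Const 0)) (Var ''a''))
     (Store ''C'' (Var ''x'') (Const 0) (Var ''b'')) Skip)"

definition merge_edge :: com where
  "merge_edge = Cond (BAnd (Less (Const 0) (Cell ''E'' (Var ''u'') (Var ''v'')))
       (BAnd (BNot (Less (Const 0) (Cell ''D'' (Var ''i'') (Var ''u''))))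
         (BNot (Less (Const 0) (Cell ''D'' (Var ''i'') (Var ''v''))))))
     (Seq (Assign ''a'' (Cell ''C'' (Var ''u'') (Const 0)))
       (Seq (Assign ''b'' (Cell ''C'' (Var ''v'') (Const 0))) relabel)) Skip"

definition merge_edges :: com where
  "merge_edges = For ''u'' ''n'' (For ''v'' ''n'' merge_edge)"

definition count_class :: com where
  "count_class = For ''x'' ''n'' (Cond (BAnd (BNot (Less (Const 0) (Cell ''D'' (Var ''i'') (Var ''x''))))
       (equal_test (Cell ''C'' (Var ''x'') (Const 0)) (Var ''a'')))
     (Assign ''cnt'' (Add (Var ''cnt'') (Const 1))) Skip)"

definition check_classes :: com where
  "check_classes = Seq (Assign ''bad'' (Const 0)) (For ''a'' ''n''
     (Seq (Assign ''cnt'' (Const 0)) (Seq count_class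
       (Cond (Less (Var ''n'') (Add (Var ''cnt'') (Var ''cnt''))) (Assign ''bad'' (Const 1)) Skip))))"

definition write_output :: com where
  "write_output = For ''x'' ''n''
     (Seq (Store ''X'' (Var ''x'') (Const 0) (Cell ''D'' (Var ''i'') (Var ''x'')))
       (Seq (Store ''L'' (Var ''x'') (Const 0) (Cell ''C'' (Var ''x'') (Const 0)))
         (Seq (Store ''L'' (Var ''x'') (Const 1) (Cell ''C'' (Var ''x'') (Const 0)))
           (Store ''L'' (Var ''x'') (Const 2) (Cell ''C'' (Var ''x'') (Const 0))))))"

text \<open>The output arrays are touched only by a row that passes the test. So the search needs no
  early exit: failing rows preserve an earlier result, and a later success replaces it by another
  valid one.\<close>

definition try_row :: com where
  "try_row = Seq init_labels (Seq merge_edges (Seq check_classes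
     (Cond (Less (Var ''bad'') (Const 1)) write_output Skip)))"

definition find_disperser :: "nat \<Rightarrow> com" where
  "find_disperser k = Seq (Assign ''m'' (Const 1)) (Seq (Assign ''h'' (Var ''n''))
     (Seq (stages k) (For ''i'' ''m'' try_row)))"

lemma written_search [simp]:
  "written_regs init_labels = {''x''}" "written_arrays init_labels = {''C''}"
  "written_regs relabel = {''x''}" "written_arrays relabel = {''C''}"
  "written_regs merge_edge = {''a'', ''b'', ''x''}" "written_arrays merge_edge = {''C''}"
  "written_regs merge_edges = {''a'', ''b'', ''x'', ''u'', ''v''}" "written_arrays merge_edges = {''C''}"
  "written_regs count_class = {''x'', ''cnt''}" "written_arrays count_class = {}"
  "written_regs check_classes = {''x'', ''cnt'', ''bad'', ''a''}" "written_arrays check_classes = {}"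
  "written_regs write_output = {''x''}" "written_arrays write_output = {''X'', ''L''}"
  by (auto simp: init_labels_def relabel_def merge_edge_def merge_edges_def count_class_def
      check_classes_def write_output_def)

lemma written_try_row [simp]:
  "written_regs try_row = {''a'', ''b'', ''x'', ''u'', ''v'', ''cnt'', ''bad''}"
  "written_arrays try_row = {''C'', ''X'', ''L''}"
  by (auto simp: try_row_def)

section \<open>Correctness of these programs\<close>

lemma runs_init_labels:
  assumes "n = regs s ''n''"
  shows "runs init_labels s (n * 12 + 6) (\<lambda>s'. \<forall>x<n. cells s' ''C'' x 0 = x)"
  unfolding init_labels_def
proof (rule runs_For[where Inv = "\<lambda>i s'. \<forall>x<i. cells s' ''C'' x 0 = x" and B = 4])
  fix i and s' :: state
  assume "regs s' ''x'' = i" "\<forall>x<i. cells s' ''C'' x 0 = x"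
  then show "runs (Store ''C'' (Var ''x'') (Const 0) (Var ''x'')) s' 4
      (\<lambda>s''. \<forall>x<Suc i. cells (s''\<lparr>regs := (regs s'')(''x'' := Suc i)\<rparr>) ''C'' x 0 = x)"
    by (intro runs_Store) (auto simp: store_def less_Suc_eq)
qed (use assms in auto)

lemma runs_relabel:
  assumes "n = regs s ''n''" "a = regs s ''a''" "b = regs s ''b''"
  shows "runs relabel s (n * 26 + 6) (\<lambda>s'. \<forall>x<n. cells s' ''C'' x 0 =
    (if cells s ''C'' x 0 = a then b else cells s ''C'' x 0))"
  unfolding relabel_def
\<comment> \<open>The invariant covers all \<open>x\<close>, since the remaining rounds rely on the
  entries from \<open>i\<close> on being still the original ones.\<close>
proof (rule runs_For[where Inv = "\<lambda>i s'. \<forall>x. cells s' ''C'' x 0 =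
    (if x < i \<and> cells s ''C'' x 0 = a then b else cells s ''C'' x 0)" and B = 18])
  let ?c = "Cond (equal_test (Cell ''C'' (Var ''x'') (Const 0)) (Var ''a''))
     (Store ''C'' (Var ''x'') (Const 0) (Var ''b'')) Skip"
  fix i and s' :: state
  assume s': "regs s' ''x'' = i" "frame (For ''x'' ''n'' ?c) s s'"
    "\<forall>x. cells s' ''C'' x 0 = (if x < i \<and> cells s ''C'' x 0 = a then b else cells s ''C'' x 0)"
  have "regs s' ''a'' = a" "regs s' ''b'' = b" using s'(2) assms by (auto simp: frame_def)
  then show "runs ?c s' 18
      (\<lambda>s''. \<forall>x. cells (s''\<lparr>regs := (regs s'')(''x'' := Suc i)\<rparr>) ''C'' x 0 =
        (if x < Suc i \<and> cells s ''C'' x 0 = a then b else cells s ''C'' x 0))"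
    using s' by (intro runs_Cond[where ?B1.0 = 4] runs_Store runs_Skip)
      (auto simp: store_def less_Suc_eq split: if_splits)
qed (use assms in auto)

lemma runs_merge_edge:
  assumes G: "input_ok G n s" and W: "W = {x. x < n \<and> cells s ''D'' (regs s ''i'') x = 0}"
    and uv: "regs s ''u'' = u" "regs s ''v'' = v" "u < n" "v < n"
    and l: "labelling G n W (\<lambda>x. cells s ''C'' x 0) P"
  shows "runs merge_edge s (26 * n + 34) (\<lambda>s'. labelling G n W (\<lambda>x. cells s' ''C'' x 0) (insert (u, v) P))"
  unfolding merge_edge_def
proof (rule runs_Cond[where ?B1.0 = "26 * n + 14"])
  let ?b = "BAnd (Less (Const 0) (Cell ''E'' (Var ''u'') (Var ''v'')))
       (BAnd (BNot (Less (Const 0) (Cell ''D'' (Var ''i'') (Var ''u''))))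
         (BNot (Less (Const 0) (Cell ''D'' (Var ''i'') (Var ''v'')))))"
  have b: "bval s ?b \<longleftrightarrow> adj G u v \<and> u \<in> W \<and> v \<in> W"
    using G uv by (auto simp: W input_ok_def)
  show "runs Skip s (26 * n + 14) (\<lambda>s'. labelling G n W (\<lambda>x. cells s' ''C'' x 0) (insert (u, v) P))"
    if "\<not> bval s ?b"
    using labelling_skip[OF l] that b by (intro runs_Skip) auto
  assume "bval s ?b"
  then have adj: "adj G u v" "u \<in> W" "v \<in> W" using b by auto
  let ?l = "\<lambda>x. cells s ''C'' x 0"
  show "runs (Seq (Assign ''a'' (Cell ''C'' (Var ''u'') (Const 0)))
       (Seq (Assign ''b'' (Cell ''C'' (Var ''v'') (Const 0))) relabel)) s (26 * n + 14)
       (\<lambda>s'. labelling G n W (\<lambda>x. cells s' ''C'' x 0) (insert (u, v) P))"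
  proof (rule runs_Seq)
    let ?s1 = "s\<lparr>regs := (regs s)(''a'' := ?l u)\<rparr>"
    show "runs (Assign ''a'' (Cell ''C'' (Var ''u'') (Const 0))) s 4 (\<lambda>t. t = ?s1)"
      using uv by (intro runs_Assign) auto
    fix t assume t: "t = ?s1"
    show "runs (Seq (Assign ''b'' (Cell ''C'' (Var ''v'') (Const 0))) relabel) t (26 * n + 10)
       (\<lambda>s'. labelling G n W (\<lambda>x. cells s' ''C'' x 0) (insert (u, v) P))"
    proof (rule runs_Seq)
      let ?s2 = "t\<lparr>regs := (regs t)(''b'' := ?l v)\<rparr>"
      show "runs (Assign ''b'' (Cell ''C'' (Var ''v'') (Const 0))) t 4 (\<lambda>t'. t' = ?s2)"
        using uv t by (intro runs_Assign) auto
      fix t' assume t': "t' = ?s2"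
      have n: "n = regs t' ''n''" using G t t' by (simp add: input_ok_def)
      have WV: "W \<subseteq> {..<n}" by (auto simp: W)
      from runs_relabel[OF n refl refl]
      show "runs relabel t' (26 * n + 6)
          (\<lambda>s'. labelling G n W (\<lambda>x. cells s' ''C'' x 0) (insert (u, v) P))"
        by (rule runs_mono) (use t t' labelling_merge[OF l WV adj(2,3,1)] in auto)
    qed simp
  qed simp
qed simp

text \<open>The predecessors of \<open>(u, v)\<close> in lexicographic order, i.e. the pairs that
  two nested loops have finished. The end of a row coincides with the start of the next, which links
  the inner invariant to the outer one.\<close>

definition pairs_before :: "nat \<Rightarrow> nat \<Rightarrow> nat \<Rightarrow> (nat \<times> nat) set" where
  "pairs_before n u v = {(x, y). x < u \<and> y < n \<or> x = u \<and> y < v}"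

lemma pairs_before_simps:
  "pairs_before n 0 0 = {}"
  "pairs_before n u (Suc v) = insert (u, v) (pairs_before n u v)"
  "pairs_before n (Suc u) 0 = pairs_before n u n"
  by (auto simp: pairs_before_def less_Suc_eq)

lemma runs_merge_edges:
  assumes G: "input_ok G n s" and W: "W = {x. x < n \<and> cells s ''D'' (regs s ''i'') x = 0}"
    and l: "labelling G n W (\<lambda>x. cells s ''C'' x 0) {}"
  shows "runs merge_edges s (n * (n * (26 * n + 42) + 14) + 6)
    (\<lambda>s'. labelling G n W (\<lambda>x. cells s' ''C'' x 0) ({..<n} \<times> {..<n}))"
proof -
  have n: "n = regs s ''n''" using G by (simp add: input_ok_def)
  let ?I = "\<lambda>u v s'. labelling G n W (\<lambda>x. cells s' ''C'' x 0) (pairs_before n u v)"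
  show ?thesis
    unfolding merge_edges_def
  proof (rule runs_For[where Inv = "\<lambda>u. ?I u 0" and B = "n * (26 * n + 42) + 6"])
    fix u and s' :: state
    assume u: "u < regs s ''n''" "regs s' ''u'' = u"
      "frame (For ''u'' ''n'' (For ''v'' ''n'' merge_edge)) s s'" "?I u 0 s'"
    have n': "regs s' ''n'' = n" using u(3) n by (simp add: frame_def)
    show "runs (For ''v'' ''n'' merge_edge) s' (n * (26 * n + 42) + 6)
        (\<lambda>s''. ?I (Suc u) 0 (s''\<lparr>regs := (regs s'')(''u'' := Suc u)\<rparr>))"
    proof (rule runs_For[where Inv = "?I u" and B = "26 * n + 34"])
      fix v and t :: state
      assume v: "v < regs s' ''n''" "regs t ''v'' = v" "frame (For ''v'' ''n'' merge_edge) s' t"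
        "?I u v t"
      have fr: "frame (For ''u'' ''n'' (For ''v'' ''n'' merge_edge)) s t"
        using u(3) v(3) by (auto simp: frame_def)
      have G': "input_ok G n t" using input_ok_frame[OF G fr] by simp
      have "regs t ''i'' = regs s ''i''" "cells t ''D'' = cells s ''D''"
        using fr by (auto simp: frame_def)
      then have W': "W = {x. x < n \<and> cells t ''D'' (regs t ''i'') x = 0}" using W by simp
      have ut: "regs t ''u'' = u" using v(3) u(2) by (simp add: frame_def)
      from runs_merge_edge[OF G' W' ut v(2) _ _ v(4)]
      have "runs merge_edge t (26 * n + 34)
          (\<lambda>s'. labelling G n W (\<lambda>x. cells s' ''C'' x 0) (insert (u, v) (pairs_before n u v)))"
        using u(1) v(1) n n' by simp
      then show "runs merge_edge t (26 * n + 34)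
          (\<lambda>s''. ?I u (Suc v) (s''\<lparr>regs := (regs s'')(''v'' := Suc v)\<rparr>))"
        by (simp add: pairs_before_simps)
    qed (use u n' pairs_before_simps in auto)
  next
    fix s' :: state assume "?I (regs s ''n'') 0 s'"
    then show "labelling G n W (\<lambda>x. cells s' ''C'' x 0) ({..<n} \<times> {..<n})"
      using n by (auto simp: labelling_def pairs_before_def)
  qed (use l n pairs_before_simps in auto)
qed

lemma runs_count_class:
  assumes "n = regs s ''n''" "regs s ''cnt'' = 0"
  shows "runs count_class s (n * 33 + 6) (\<lambda>s'. regs s' ''cnt'' =
    card {x. x < n \<and> cells s ''D'' (regs s ''i'') x = 0 \<and> cells s ''C'' x 0 = regs s ''a''})"
proof -
  let ?p = "\<lambda>x. cells s ''D'' (regs s ''i'') x = 0 \<and> cells s ''C'' x 0 = regs s ''a''"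
  have card_Suc: "card {x. x < Suc i \<and> ?p x} = card {x. x < i \<and> ?p x} + (if ?p i then 1 else 0)" for i
  proof -
    have "{x. x < Suc i \<and> ?p x} = (if ?p i then insert i else id) {x. x < i \<and> ?p x}"
      by (auto simp: less_Suc_eq)
    then show ?thesis by simp
  qed
  let ?c = "Cond (BAnd (BNot (Less (Const 0) (Cell ''D'' (Var ''i'') (Var ''x''))))
       (equal_test (Cell ''C'' (Var ''x'') (Const 0)) (Var ''a'')))
     (Assign ''cnt'' (Add (Var ''cnt'') (Const 1))) Skip"
  show ?thesis
    unfolding count_class_def
  proof (rule runs_For[where Inv = "\<lambda>i s'. regs s' ''cnt'' = card {x. x < i \<and> ?p x}" and B = 25])
    fix i and s' :: state
    assume s': "regs s' ''x'' = i" "frame (For ''x'' ''n'' ?c) s s'"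
      "regs s' ''cnt'' = card {x. x < i \<and> ?p x}"
    have "regs s' ''a'' = regs s ''a''" "regs s' ''i'' = regs s ''i''" "cells s' = cells s"
      using s'(2) by (auto simp: frame_def)
    then have b: "bval s' (BAnd (BNot (Less (Const 0) (Cell ''D'' (Var ''i'') (Var ''x''))))
       (equal_test (Cell ''C'' (Var ''x'') (Const 0)) (Var ''a''))) \<longleftrightarrow> ?p i"
      using s'(1) by simp
    show "runs ?c s' 25
        (\<lambda>s''. regs (s''\<lparr>regs := (regs s'')(''x'' := Suc i)\<rparr>) ''cnt'' = card {x. x < Suc i \<and> ?p x})"
      unfolding card_Suc
      using s'(3) by (intro runs_Cond[where ?B1.0 = 4] runs_Assign runs_Skip; (subst (asm) b)?) auto
  qed (use assms in auto)
qed

lemma runs_check_classes: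
  assumes n: "n = regs s ''n''"
  shows "runs check_classes s (n * (33 * n + 24) + 8) (\<lambda>s'. regs s' ''bad'' = 0 \<longleftrightarrow>
    (\<forall>a<n. 2 * card {x. x < n \<and> cells s ''D'' (regs s ''i'') x = 0 \<and> cells s ''C'' x 0 = a} \<le> n))"
proof -
  let ?k = "\<lambda>a. card {x. x < n \<and> cells s ''D'' (regs s ''i'') x = 0 \<and> cells s ''C'' x 0 = a}"
  let ?I = "\<lambda>i s'. regs s' ''bad'' = 0 \<longleftrightarrow> (\<forall>a<i. 2 * ?k a \<le> n)"
  let ?t = "Cond (Less (Var ''n'') (Add (Var ''cnt'') (Var ''cnt''))) (Assign ''bad'' (Const 1)) Skip"
  let ?c = "Seq (Assign ''cnt'' (Const 0)) (Seq count_class ?t)"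
  show ?thesis
    unfolding check_classes_def
  proof (rule runs_Seq)
    let ?s1 = "s\<lparr>regs := (regs s)(''bad'' := 0)\<rparr>"
    show "runs (Assign ''bad'' (Const 0)) s 2 (\<lambda>t. t = ?s1)" by (intro runs_Assign) auto
    fix t assume t: "t = ?s1"
    show "runs (For ''a'' ''n'' ?c) t (n * (33 * n + 24) + 6) (?I n)"
    proof (rule runs_For[where Inv = ?I and B = "33 * n + 16"])
      fix i and s' :: state
      assume s': "regs s' ''a'' = i" "frame (For ''a'' ''n'' ?c) t s'" "?I i s'"
      have eq: "regs s' ''n'' = n" "regs s' ''i'' = regs s ''i''" "cells s' = cells s"
        using s'(2) t n by (auto simp: frame_def)
      show "runs ?c s' (33 * n + 16) (\<lambda>s''. ?I (Suc i) (s''\<lparr>regs := (regs s'')(''a'' := Suc i)\<rparr>))"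
      proof (rule runs_Seq)
        let ?s2 = "s'\<lparr>regs := (regs s')(''cnt'' := 0)\<rparr>"
        show "runs (Assign ''cnt'' (Const 0)) s' 2 (\<lambda>t. t = ?s2)" by (intro runs_Assign) auto
        fix t2 assume t2: "t2 = ?s2"
        show "runs (Seq count_class ?t) t2 (33 * n + 14)
            (\<lambda>s''. ?I (Suc i) (s''\<lparr>regs := (regs s'')(''a'' := Suc i)\<rparr>))"
        proof (rule runs_Seq)
          show "runs count_class t2 (n * 33 + 6) (\<lambda>s''. regs s'' ''cnt'' = ?k i)"
            using runs_count_class[of n t2] t2 eq s'(1) by simp
          fix t3 assume t3: "regs t3 ''cnt'' = ?k i" "frame count_class t2 t3"
          have "regs t3 ''n'' = n" "regs t3 ''bad'' = regs s' ''bad''"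
            using t3(2) t2 eq by (auto simp: frame_def)
          then show "runs ?t t3 8 (\<lambda>s''. ?I (Suc i) (s''\<lparr>regs := (regs s'')(''a'' := Suc i)\<rparr>))"
            using t3(1) s'(3) by (intro runs_Cond[where ?B1.0 = 2] runs_Assign runs_Skip)
              (auto simp: less_Suc_eq not_le)
        qed simp
      qed simp
    qed (use t n in auto)
  qed simp
qed

lemma runs_write_output:
  assumes n: "n = regs s ''n''"
  shows "runs write_output s (n * 32 + 6) (\<lambda>s'. \<forall>x<n.
    cells s' ''X'' x 0 = cells s ''D'' (regs s ''i'') x \<and> cells s' ''L'' x 0 = cells s ''C'' x 0 \<and>
    cells s' ''L'' x 1 = cells s ''C'' x 0 \<and> cells s' ''L'' x 2 = cells s ''C'' x 0)"
proof -
  let ?I = "\<lambda>i s'. \<forall>x<i.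
    cells s' ''X'' x 0 = cells s ''D'' (regs s ''i'') x \<and> cells s' ''L'' x 0 = cells s ''C'' x 0 \<and>
    cells s' ''L'' x 1 = cells s ''C'' x 0 \<and> cells s' ''L'' x 2 = cells s ''C'' x 0"
  let ?st = "\<lambda>A k a. Store A (Var ''x'') (Const k) a"
  let ?C = "Cell ''C'' (Var ''x'') (Const 0)"
  let ?c = "Seq (?st ''X'' 0 (Cell ''D'' (Var ''i'') (Var ''x'')))
       (Seq (?st ''L'' 0 ?C) (Seq (?st ''L'' 1 ?C) (?st ''L'' 2 ?C)))"
  show ?thesis
    unfolding write_output_def
  proof (rule runs_For[where Inv = ?I and B = 24])
    fix i and s' :: state
    assume s': "regs s' ''x'' = i" "frame (For ''x'' ''n'' ?c) s s'" "?I i s'"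
    have eq: "regs s' ''i'' = regs s ''i''" "cells s' ''D'' = cells s ''D''" "cells s' ''C'' = cells s ''C''"
      using s'(2) by (auto simp: frame_def)
    let ?a = "cells s' ''D'' (regs s' ''i'') i" and ?l = "cells s' ''C'' i 0"
    show "runs ?c s' 24 (\<lambda>s''. ?I (Suc i) (s''\<lparr>regs := (regs s'')(''x'' := Suc i)\<rparr>))"
    proof (rule runs_Seq)
      let ?s1 = "store ''X'' i 0 ?a s'"
      show "runs (?st ''X'' 0 (Cell ''D'' (Var ''i'') (Var ''x''))) s' 6 (\<lambda>t. t = ?s1)"
        using s'(1) by (intro runs_Store) auto
      fix t assume t: "t = ?s1"
      show "runs (Seq (?st ''L'' 0 ?C) (Seq (?st ''L'' 1 ?C) (?st ''L'' 2 ?C))) t 18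
          (\<lambda>s''. ?I (Suc i) (s''\<lparr>regs := (regs s'')(''x'' := Suc i)\<rparr>))"
      proof (rule runs_Seq)
        let ?s2 = "store ''L'' i 0 ?l t"
        show "runs (?st ''L'' 0 ?C) t 6 (\<lambda>t. t = ?s2)"
          using s'(1) t by (intro runs_Store) (auto simp: store_def)
        fix t2 assume t2: "t2 = ?s2"
        show "runs (Seq (?st ''L'' 1 ?C) (?st ''L'' 2 ?C)) t2 12
            (\<lambda>s''. ?I (Suc i) (s''\<lparr>regs := (regs s'')(''x'' := Suc i)\<rparr>))"
        proof (rule runs_Seq)
          let ?s3 = "store ''L'' i 1 ?l t2"
          show "runs (?st ''L'' 1 ?C) t2 6 (\<lambda>t. t = ?s3)"
            using s'(1) t t2 by (intro runs_Store) (auto simp: store_def)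
          fix t3 assume "t3 = ?s3"
          then show "runs (?st ''L'' 2 ?C) t3 6
              (\<lambda>s''. ?I (Suc i) (s''\<lparr>regs := (regs s'')(''x'' := Suc i)\<rparr>))"
            using s' t t2 eq by (intro runs_Store) (auto simp: store_def less_Suc_eq)
        qed simp
      qed simp
    qed simp
  qed (use n in auto)
qed

section \<open>Soundness and success of the search\<close>

definition balanced :: "nat graph \<Rightarrow> nat set \<Rightarrow> bool" where
  "balanced G X \<longleftrightarrow>
     (\<forall>C\<subseteq>verts G - X. connected_within G C \<longrightarrow> 2 * card C \<le> card (verts G))"

text \<open>Vertices with equal labels are joined by a walk outside \<open>X\<close>, so a class
  lies in one component. This half of \<open>labelling\<close> guarantees that a balanced row passes
  the test; the other half, equal labels along edges, makes the output
  \<open>separated\<close>.\<close>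

lemma balanced_classes:
  assumes G: "verts G = {..<n}" and X: "balanced G X" and l: "labelling G n ({..<n} - X) l P"
  shows "2 * card {x. x < n \<and> x \<notin> X \<and> l x = a} \<le> n"
proof (cases "{x. x < n \<and> x \<notin> X \<and> l x = a} = {}")
  case True
  then show ?thesis by (simp only: card.empty)
next
  case False
  let ?W = "{..<n} - X"
  obtain y where y: "y \<in> ?W" "l y = a" using False by auto
  define C where "C = component_within G ?W y"
  have C: "C \<subseteq> ?W" unfolding C_def by (rule component_within_subset[OF y(1)])
  then have "2 * card C \<le> n"
    using X G connected_within_component[of G ?W y] by (simp add: balanced_def C_def)
  moreover have "{x. x < n \<and> x \<notin> X \<and> l x = a} \<subseteq> C"
    using l y by (auto simp: C_def component_within_def labelling_def)
  then have "card {x. x < n \<and> x \<notin> X \<and> l x = a} \<le> card C"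
    using C finite_subset[OF C] by (intro card_mono) auto
  ultimately show ?thesis by linarith
qed

text \<open>Whatever passes the size test is valid by the test itself; \<open>balanced\<close> only
  serves to show that some row does pass.\<close>

lemma runs_try_row:
  assumes G: "input_ok G n s" and X: "X = {v. v < n \<and> cells s ''D'' (regs s ''i'') v \<noteq> 0}"
    "X \<in> small_nbhds G k"
  shows "runs try_row s (90 * (n + 2) ^ 3)
    (\<lambda>s'. balanced G X \<or> valid_output G n k s \<longrightarrow> valid_output G n k s')"
  unfolding try_row_def
proof (rule runs_Seq)
  let ?W = "{..<n} - X" and ?post = "\<lambda>s'. balanced G X \<or> valid_output G n k s \<longrightarrow> valid_output G n k s'"
  let ?fin = "Cond (Less (Var ''bad'') (Const 1)) write_output Skip"
  have n: "n = regs s ''n''" using G by (simp add: input_ok_def)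
  show "runs init_labels s (n * 12 + 6) (\<lambda>s'. \<forall>x<n. cells s' ''C'' x 0 = x)"
    by (rule runs_init_labels[OF n])
  fix t assume t: "\<forall>x<n. cells t ''C'' x 0 = x" "frame init_labels s t"
  show "runs (Seq merge_edges (Seq check_classes ?fin)) t
      ((n * (n * (26 * n + 42) + 14) + 6) + ((n * (33 * n + 24) + 8) + (32 * n + 10))) ?post"
  proof (rule runs_Seq)
    have Gt: "input_ok G n t" using input_ok_frame[OF G t(2)] by simp
    have Wt: "?W = {x. x < n \<and> cells t ''D'' (regs t ''i'') x = 0}"
      using t(2) X(1) by (auto simp: frame_def)
    show "runs merge_edges t (n * (n * (26 * n + 42) + 14) + 6)
        (\<lambda>s'. labelling G n ?W (\<lambda>x. cells s' ''C'' x 0) ({..<n} \<times> {..<n}))"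
      using labelling_init[of ?W n "\<lambda>x. cells t ''C'' x 0" G] t(1)
      by (intro runs_merge_edges[OF Gt Wt]) auto
    fix u assume u: "labelling G n ?W (\<lambda>x. cells u ''C'' x 0) ({..<n} \<times> {..<n})"
      "frame merge_edges t u"
    let ?l = "\<lambda>x. cells u ''C'' x 0"
    have u_eq: "regs u ''i'' = regs s ''i''" "cells u ''D'' = cells s ''D''" "regs u ''n'' = n"
      "cells u ''X'' = cells s ''X''" "cells u ''L'' = cells s ''L''"
      using u(2) t(2) n by (auto simp: frame_def)
    have class_eq: "{x. x < n \<and> cells u ''D'' (regs u ''i'') x = 0 \<and> cells u ''C'' x 0 = a} =
        {x. x < n \<and> x \<notin> X \<and> ?l x = a}" for a
      using u_eq X(1) by auto
    show "runs (Seq check_classes ?fin) u ((n * (33 * n + 24) + 8) + (32 * n + 10)) ?post"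
    proof (rule runs_Seq[OF runs_check_classes[OF u_eq(3)[symmetric]]])
      fix v assume v: "regs v ''bad'' = 0 \<longleftrightarrow> (\<forall>a<n. 2 * card
          {x. x < n \<and> cells u ''D'' (regs u ''i'') x = 0 \<and> cells u ''C'' x 0 = a} \<le> n)"
        "frame check_classes u v"
      have bad: "regs v ''bad'' = 0 \<longleftrightarrow> (\<forall>a<n. 2 * card {x. x < n \<and> x \<notin> X \<and> ?l x = a} \<le> n)"
        using v(1) unfolding class_eq .
      have v_eq: "regs v ''i'' = regs s ''i''" "cells v ''D'' = cells s ''D''" "regs v ''n'' = n"
        "cells v ''X'' = cells s ''X''" "cells v ''L'' = cells s ''L''" "cells v ''C'' = cells u ''C''"
        using v(2) u_eq by (auto simp: frame_def)
      show "runs ?fin v (32 * n + 10) ?post"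
      proof (rule runs_Cond[where ?B1.0 = "32 * n + 6"])
        assume "bval v (Less (Var ''bad'') (Const 1))"
        then have small: "\<forall>a<n. 2 * card {x. x < n \<and> x \<notin> X \<and> ?l x = a} \<le> n" using bad by simp
        from runs_write_output[OF v_eq(3)[symmetric]]
        show "runs write_output v (32 * n + 6) ?post"
        proof (rule runs_mono)
          fix w :: state assume w: "\<forall>x<n. cells w ''X'' x 0 = cells v ''D'' (regs v ''i'') x \<and>
            cells w ''L'' x 0 = cells v ''C'' x 0 \<and> cells w ''L'' x 1 = cells v ''C'' x 0 \<and>
            cells w ''L'' x 2 = cells v ''C'' x 0"
          have "out_set n w = X" using w v_eq X(1) by (auto simp: out_set_def)
          moreover have "{x. x < n \<and> x \<notin> X \<and> cells w ''L'' x 0 = a} = {x. x < n \<and> x \<notin> X \<and> ?l x = a}" for a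
            using w v_eq by auto
          ultimately have "valid_output G n k w"
            using w v_eq small u(1) X(2) by (auto simp: valid_output_def separated_def labelling_def)
          then show "?post w" by simp
        qed simp
      next
        \<comment> \<open>A failing row is not balanced, and up to here neither \<open>X\<close> nor
          \<open>L\<close> has been written, so validity before and after the attempt are
          equivalent.\<close>
        assume "\<not> bval v (Less (Var ''bad'') (Const 1))"
        then have "\<not> balanced G X"
          using bad balanced_classes[OF _ _ u(1)] G by (auto simp: input_ok_def)
        moreover have "valid_output G n k v \<longleftrightarrow> valid_output G n k s"
          using v_eq by (simp add: valid_output_def out_set_def)
        ultimately show "runs Skip v (32 * n + 6) ?post" by (intro runs_Skip) auto
      qed simp
    qed simp
  qed simp
qed (simp add: power3_eq_cube algebra_simps)

text \<open>The set \<open>S\<close> is unknown to the program; its existence puts a balanced row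
  among those enumerated. The number \<open>k\<close> does not grow with the graph, so the exponent
  \<open>k + 3\<close> is constant and the time polynomial.\<close>

lemma runs_find_disperser:
  assumes G: "input_ok G n s" and D: "cells s ''D'' = (\<lambda>_ _. 0)" and H: "cells s ''H'' = (\<lambda>_ _. 0)"
    and S: "S \<subseteq> verts G" "card S \<le> k" "balanced G (open_nbhd G S)"
  shows "runs (find_disperser k) s ((18 * k + 126) * (n + 2) ^ (k + 3))
    (\<lambda>s'. regs s' ''h'' = n \<and> cells s' ''H'' = (\<lambda>_ _. 0) \<and> valid_output G n k s')"
  unfolding find_disperser_def
proof (rule runs_Seq)
  let ?M = "(n + 1) ^ k"
  let ?B3 = "?M * (90 * (n + 2) ^ 3 + 8) + 6"
  let ?B2 = "18 * (k + 1) * (n + 2) ^ (0 + k + 2)"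
  let ?P = "\<lambda>j t. input_ok G n t \<and> enumerated G n j t \<and> cells t ''H'' = (\<lambda>_ _. 0)"
  let ?post = "\<lambda>s'. regs s' ''h'' = n \<and> cells s' ''H'' = (\<lambda>_ _. 0) \<and> valid_output G n k s'"
  show "runs (Assign ''m'' (Const 1)) s 2 (?P 0)"
    using G D H by (intro runs_Assign) (auto simp: input_ok_def intro!: enumerated_0)
  show "2 + (2 + (?B2 + ?B3)) \<le> (18 * k + 126) * (n + 2) ^ (k + 3)"
  proof -
    define Z where "Z = (n + 2) ^ (k + 3)"
    have "1 \<le> Z" unfolding Z_def by (intro one_le_power) simp
    have "?B2 \<le> 18 * (k + 1) * Z"
      unfolding Z_def by (intro mult_le_mono2 power_increasing) auto
    moreover have "?M * (90 * (n + 2) ^ 3 + 8) \<le> 98 * Z"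
    proof -
      have "?M \<le> (n + 2) ^ k" by (intro power_mono) auto
      moreover have "1 \<le> (n + 2) ^ 3" by (intro one_le_power) simp
      then have "90 * (n + 2) ^ 3 + 8 \<le> 98 * (n + 2) ^ 3" by linarith
      ultimately have "?M * (90 * (n + 2) ^ 3 + 8) \<le> (n + 2) ^ k * (98 * (n + 2) ^ 3)"
        by (rule mult_le_mono)
      also have "\<dots> = 98 * Z" unfolding Z_def by (simp only: power_add mult_ac)
      finally show ?thesis .
    qed
    \<comment> \<open>The 10 collects the two assignments and the constant 6 of the loop; together
      with 18 from the stages and 98 = 90 + 8 from the rows it makes up 126.\<close>
    ultimately have "2 + (2 + (?B2 + ?B3)) \<le> 10 * Z + 18 * (k + 1) * Z + 98 * Z"
      using \<open>1 \<le> Z\<close> by linarith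
    also have "\<dots> = (18 * k + 126) * Z" by (simp add: algebra_simps)
    finally show ?thesis unfolding Z_def .
  qed
  fix t assume t: "?P 0 t"
  show "runs (Seq (Assign ''h'' (Var ''n'')) (Seq (stages k) (For ''i'' ''m'' try_row))) t
      (2 + (?B2 + ?B3)) ?post"
  proof (rule runs_Seq)
    show "runs (Assign ''h'' (Var ''n'')) t 2 (\<lambda>t. ?P 0 t \<and> regs t ''h'' = n)"
      using t by (intro runs_Assign) (auto simp: input_ok_def enumerated_def out_family_def)
    fix u assume u: "?P 0 u \<and> regs u ''h'' = n"
    then have run: "runs (stages k) u ?B2 (enumerated G n (0 + k))"
      by (intro runs_stages) auto
    show "runs (Seq (stages k) (For ''i'' ''m'' try_row)) u (?B2 + ?B3) ?post"
    proof (rule runs_Seq[OF run])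
      fix v assume v: "enumerated G n (0 + k) v" "frame (stages k) u v"
      have Gv: "input_ok G n v"
        using written_stages[of k] u by (intro input_ok_frame[OF _ v(2)]) auto
      have v_eq: "regs v ''h'' = n" "cells v ''H'' = (\<lambda>_ _. 0)"
        using written_stages[of k] u v(2) frame_regs[OF v(2), of "''h''"]
          frame_cells[OF v(2), of "''H''"] by auto
      let ?row = "\<lambda>j. {x. x < n \<and> cells v ''D'' j x \<noteq> 0}"
      have m: "regs v ''m'' = ?M" and fam: "?row ` {..<?M} = small_nbhds G k"
        using v(1) by (auto simp: enumerated_def out_family_def)
      show "runs (For ''i'' ''m'' try_row) v ?B3 ?post"
      proof (rule runs_For[where B = "90 * (n + 2) ^ 3" and
          Inv = "\<lambda>i s'. (\<exists>j<i. balanced G (?row j)) \<longrightarrow> valid_output G n k s'"])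
        fix i and s' :: state
        assume i: "i < regs v ''m''" "regs s' ''i'' = i" "frame (For ''i'' ''m'' try_row) v s'"
          "(\<exists>j<i. balanced G (?row j)) \<longrightarrow> valid_output G n k s'"
        have G': "input_ok G n s'" using input_ok_frame[OF Gv i(3)] by simp
        have row: "?row i = {x. x < n \<and> cells s' ''D'' (regs s' ''i'') x \<noteq> 0}"
          using i(2,3) by (simp add: frame_def)
        have "?row i \<in> small_nbhds G k" using i(1) m fam by auto
        from runs_try_row[OF G' row this]
        show "runs try_row s' (90 * (n + 2) ^ 3) (\<lambda>s''. (\<exists>j<Suc i. balanced G (?row j)) \<longrightarrow>
            valid_output G n k (s''\<lparr>regs := (regs s'')(''i'' := Suc i)\<rparr>))"
          by (rule runs_mono)
            (use i(4) in \<open>auto simp: less_Suc_eq valid_output_def out_set_def\<close>)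
      next
        fix s' :: state
        assume s': "(\<exists>j<regs v ''m''. balanced G (?row j)) \<longrightarrow> valid_output G n k s'"
          "frame (For ''i'' ''m'' try_row) v s'"
        have "open_nbhd G S \<in> ?row ` {..<?M}" using S unfolding fam small_nbhds_def by blast
        then have "\<exists>j<?M. balanced G (?row j)" using S(3) by auto
        then have "valid_output G n k s'" using s'(1) m by simp
        then show "?post s'" using s'(2) v_eq by (simp add: frame_def)
      qed (use m in auto)
    qed simp
  qed simp
qed

lemma uniformly_dispersible_long_cycle_free: "uniformly_dispersible (1 / 2) (long_cycle_free t)"
  unfolding uniformly_dispersible_def
proof (intro conjI hereditary_long_cycle_free)
  define T where "T = t + 3"
  define p :: "real poly" where "p = smult (real (18 * T + 126)) ([:2, 1:] ^ (T + 3))"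
  have p: "poly p (real n) = real ((18 * T + 126) * (n + 2) ^ (T + 3))" for n
    by (simp add: p_def add.commute)
  have main: "\<exists>T' s. exec (find_disperser T) (graph_input G) T' s \<and> real T' \<le> poly p (real n) \<and>
      real (regs s ''h'') \<le> poly p (real n) \<and>
      uniform_disperser (1 / 2) G (out_set n s) (out_pattern s) (out_eta n s) (out_iota n s)"
    if G: "G \<in> long_cycle_free t" "verts G = {..<n}" and n: "n \<ge> 4"
      and deg: "\<forall>v\<in>verts G. real (card (closed_nbhd G v)) \<le> 1 / (2 * real T) * real n powr (1 / 2)"
    for n G
  proof -
    have simple: "simple_graph G" using long_cycle_free_shift(1) G by blast
    have T1: "T \<ge> 1" by (simp add: T_def)
    have free: "\<not> has_induced G (cycle_graph l)" if "l \<ge> T" for l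
      using long_cycle_free_shift(2)[OF G(1)] that by (simp add: T_def)
    have "2 \<le> card (verts G)" using G n by simp
    from balanced_open_nbhd_exists[OF simple T1 this free]
    obtain S where S: "S \<subseteq> verts G" "card S \<le> T" "balanced G (open_nbhd G S)"
      unfolding balanced_def by metis
    have "input_ok G n (graph_input G)" using simple G by (auto simp: input_ok_def graph_input_def)
    moreover have "cells (graph_input G) ''D'' = (\<lambda>_ _. 0)" "cells (graph_input G) ''H'' = (\<lambda>_ _. 0)"
      by (simp_all add: graph_input_def)
    ultimately have "runs (find_disperser T) (graph_input G) ((18 * T + 126) * (n + 2) ^ (T + 3))
        (\<lambda>s'. regs s' ''h'' = n \<and> cells s' ''H'' = (\<lambda>_ _. 0) \<and> valid_output G n T s')"
      by (rule runs_find_disperser[OF _ _ _ S])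
    then obtain T' s where s: "exec (find_disperser T) (graph_input G) T' s"
      "T' \<le> (18 * T + 126) * (n + 2) ^ (T + 3)"
      "regs s ''h'' = n" "cells s ''H'' = (\<lambda>_ _. 0)" "valid_output G n T s"
      unfolding runs_def by blast
    have "n \<le> (18 * T + 126) * (n + 2) ^ (T + 3)"
    proof -
      have "n \<le> 1 * (n + 2) ^ 1" by simp
      also have "\<dots> \<le> (18 * T + 126) * (n + 2) ^ (T + 3)"
        by (intro mult_le_mono power_increasing) auto
      finally show ?thesis .
    qed
    then have "real (regs s ''h'') \<le> poly p (real n)" unfolding p s(3) by (rule of_nat_mono)
    moreover have "real T' \<le> poly p (real n)" unfolding p using s(2) by (rule of_nat_mono)
    moreover have "uniform_disperser (1 / 2) G (out_set n s) (out_pattern s) (out_eta n s) (out_iota n s)"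
      by (rule uniform_disperser_valid_output[OF simple G(2) n T1 deg s(3-5)])
    ultimately show ?thesis using s(1) by blast
  qed
  show "\<exists>n0>0. \<exists>\<tau>>0. \<exists>c (p :: real poly). \<forall>n G.
      G \<in> long_cycle_free t \<and> verts G = {..<n} \<and> connected_graph G \<and> n \<ge> n0 \<and>
      (\<forall>v\<in>verts G. real (card (closed_nbhd G v)) \<le> \<tau> * real n powr (1 / 2)) \<longrightarrow>
      (\<exists>T s. exec c (graph_input G) T s \<and> real T \<le> poly p (real n) \<and>
        real (regs s ''h'') \<le> poly p (real n) \<and>
        uniform_disperser (1 / 2) G (out_set n s) (out_pattern s) (out_eta n s) (out_iota n s))"
    by (rule exI[of _ 4], rule conjI, simp, rule exI[of _ "1 / (2 * real T)"], rule conjI,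
        simp add: T_def, rule exI[of _ "find_disperser T"], rule exI[of _ p]) (use main in blast)
qed

theorem theorem5p2:
  fixes t :: nat
  shows "strongly_QP_dispersible (long_cycle_free t) \<and>
         uniformly_dispersible (1 / 2) (long_cycle_free t)"
  using strongly_QP_dispersible_long_cycle_free uniformly_dispersible_long_cycle_free by blast

end
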